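(* Let $f:\mathbb{R}^d\to\mathbb{R}$ be differentiable with $\operatorname{argmin} f\ne\emptyset$ and minimum value $f^\star$, and assume $f$ is $L$-smooth ($L>0$). Let $(x_t)$ be generated by stochastic gradient descent $x_{t+1}=x_t-\eta_tg_t$ from a deterministic $x_0\in\mathbb{R}^d$, and let $e_t=\nabla f(x_t)-g_t$. Let $\theta\ge1/2$ and $K>0$, and assume that for every $t\ge0$, conditioned on $\mathcal{F}_{t-1}$, $e_t$ is centered and $\|e_t\|$ is $K$-sub-Weibull($\theta$). If $\theta>1/2$, assume in addition that $f$ is $\rho$-Lipschitz. Let $\delta_1,\delta_2,\delta_3\in(0,1)$ and define $\delta=\max\{\delta_1,\delta_2,\delta_3\}$. Then, for $T$ iterations of SGD with $\eta_t=c/\sqrt{t+1}$ where $0<c\le1/L$, with probability at least $1-\delta_1-\delta_2-\delta_3$, $$\frac1{\sqrt T}\sum_{t=0}^{T-1}\frac1{\sqrt{t+1}}\|\nabla f(x_t)\|^2\le\frac{4(f(x_0)-f^\star)}{c\sqrt T}+\frac{\gamma(\theta)\log(1/\delta_3)}{\sqrt T}+\frac{4LK^2c\,(4e\theta\log(2/\delta_1))^{2\theta}\log(T+1)}{\sqrt T},$$ and the right-hand side is $$O\left(\frac{\log(T)\log(1/\delta)^{2\theta}+\gamma(\theta)\log(1/\delta)}{\sqrt T}\right),$$ where $$\gamma(\theta)=\begin{cases}64K^2&\theta=1/2,\\[2pt]8\max\left\{(4\theta)^\theta eK\rho,\;4(4\theta)^{2\theta}e^2K^2\right\}&\theta\in(1/2,1],\\[2pt]8\max\left\{2\log(2T/\delta_2)^{\theta-1}K\rho,\;4\left[(2^{2\theta+1}+2)\Gamma(2\theta+1)+\dfrac{2^{3\theta}\Gamma(3\theta+1)}{3\log(2T/\delta_2)^{\theta-1}}\right]K^2\right\}&\theta>1.\end{cases}$$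 Moreover $\gamma(\theta)=O\left(\log(T/\delta)^{\max\{0,\theta-1\}}\right)$ for any $\theta\ge\frac12$.
   Context: Norms are Euclidean; $e$ (without subscript) is Euler's number and $\Gamma$ is the gamma function. $f$ is $L$-smooth if $\nabla f$ is $L$-Lipschitz continuous. The $g_t$ (equivalently $e_t$) are random vectors on a probability space $(\Omega,\mathcal{F},P)$; $\mathcal{F}_t$ is the sigma algebra generated by $e_0,\dots,e_t$ and $\mathcal{F}_{-1}=\{\emptyset,\Omega\}$, so $x_t$ is $\mathcal{F}_{t-1}$-measurable. "Conditioned on $\mathcal{F}_{t-1}$, $e_t$ is centered and $\|e_t\|$ is $K$-sub-Weibull($\theta$)" means $\mathbb{E}[e_t\mid\mathcal{F}_{t-1}]=0$ and $\mathbb{E}[\exp((\|e_t\|/K)^{1/\theta})\mid\mathcal{F}_{t-1}]\le2$ almost surely. The notation $a_T=O(b_T)$ means $\limsup_{T\to\infty}|a_T|/b_T<\infty$, the other parameters being fixed. *)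

theory Defs
  imports "HOL-Probability.Probability" "HOL-Library.Landau_Symbols"
begin

definition grad :: "('v::euclidean_space \<Rightarrow> real) \<Rightarrow> 'v \<Rightarrow> 'v" where
  "grad f x = (THE D. GDERIV f x :> D)"

lemma GDERIV_unique:
  assumes "GDERIV f x :> D" "GDERIV f x :> E"
  shows "D = E"
proof -
  have "(\<lambda>h. inner h D) = (\<lambda>h. inner h E)"
    using assms unfolding gderiv_def by (rule has_derivative_unique)
  then have "inner (D - E) D = inner (D - E) E" by (rule fun_cong)
  then have "inner (D - E) (D - E) = 0" by (simp add: inner_diff_right)
  then show ?thesis by simp
qed

lemma GDERIV_imp_grad_eq: "GDERIV f x :> D \<Longrightarrow> grad f x = D"
  unfolding grad_def by (blast intro: the_equality GDERIV_unique)

lemma differentiable_imp_GDERIV_grad: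
  fixes f :: "'v::euclidean_space \<Rightarrow> real"
  assumes "f differentiable (at x)"
  shows "GDERIV f x :> grad f x"
proof -
  obtain F where F: "(f has_derivative F) (at x)"
    using assms unfolding differentiable_def by blast
  then have lin: "linear F" by (rule has_derivative_linear)
  have "F h = inner h (adjoint F 1)" for h
    using adjoint_works[OF lin, of h 1] by simp
  then have "F = (\<lambda>h. inner h (adjoint F 1))" by (rule ext)
  then have "GDERIV f x :> adjoint F 1" using F unfolding gderiv_def by metis
  then show ?thesis by (simp add: GDERIV_imp_grad_eq)
qed

text \<open>To be used for differentiable \<open>f\<close> only.\<close>

definition smooth_with :: "real \<Rightarrow> ('v::euclidean_space \<Rightarrow> real) \<Rightarrow> bool" where
  "smooth_with L f \<longleftrightarrow> lipschitz_on L UNIV (grad f)"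

text \<open>The sigma-algebra generated by \<open>e 0, \<dots>, e (t - 1)\<close>, i.e. \<open>\<F>\<close> with index \<open>t - 1\<close>.
  For \<open>t = 0\<close> it is the trivial one on \<open>space M\<close>; a supremum of
  \<open>vimage_algebra\<close>s over the empty index set would have empty space instead.\<close>

definition past_algebra :: "'w measure \<Rightarrow> (nat \<Rightarrow> 'w \<Rightarrow> 'v::topological_space) \<Rightarrow> nat \<Rightarrow> 'w measure" where
  "past_algebra M e t =
     sigma (space M) (\<Union>s\<in>{..<t}. {e s -` A \<inter> space M |A. A \<in> sets borel})"

lemma space_past_algebra [simp]: "space (past_algebra M e t) = space M"
  by (simp add: past_algebra_def space_measure_of_conv)

lemma sets_past_algebra:
  "sets (past_algebra M e t) =
     sigma_sets (space M) (\<Union>s\<in>{..<t}. {e s -` A \<inter> space M |A. A \<in> sets borel})"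
  unfolding past_algebra_def by (rule sets_measure_of) auto

lemma sets_past_algebra_0: "sets (past_algebra M e 0) = {{}, space M}"
  by (simp add: sets_past_algebra sigma_sets_empty_eq)

lemma subalgebra_past_algebra:
  assumes "\<And>s. s < t \<Longrightarrow> e s \<in> borel_measurable M"
  shows "subalgebra M (past_algebra M e t)"
  unfolding subalgebra_def sets_past_algebra
  using assms by (auto intro!: sets.sigma_sets_subset intro: measurable_sets)

text \<open>The library's \<open>real_cond_exp\<close> is scalar; for random vectors it is taken componentwise.\<close>

definition vec_cond_exp :: "'w measure \<Rightarrow> 'w measure \<Rightarrow> ('w \<Rightarrow> real ^ 'd) \<Rightarrow> 'w \<Rightarrow> real ^ 'd" where
  "vec_cond_exp M F X \<omega> = (\<chi> i. real_cond_exp M F (\<lambda>\<omega>'. X \<omega>' $ i) \<omega>)"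

definition cond_centered :: "'w measure \<Rightarrow> 'w measure \<Rightarrow> ('w \<Rightarrow> real ^ 'd) \<Rightarrow> bool" where
  "cond_centered M F X \<longleftrightarrow> (AE \<omega> in M. vec_cond_exp M F X \<omega> = 0)"

definition cond_sub_Weibull ::
    "'w measure \<Rightarrow> 'w measure \<Rightarrow> real \<Rightarrow> real \<Rightarrow> ('w \<Rightarrow> real) \<Rightarrow> bool" where
  "cond_sub_Weibull M F K \<theta> X \<longleftrightarrow>
     (AE \<omega> in M. nn_cond_exp M F (\<lambda>\<omega>'. ennreal (exp ((\<bar>X \<omega>'\<bar> / K) powr (1 / \<theta>)))) \<omega> \<le> 2)"

text \<open>Only meant for \<open>\<theta> \<ge> 1/2\<close>; it depends on \<open>\<delta>\<^sub>2\<close> and \<open>T\<close> only if \<open>\<theta> > 1\<close>.\<close>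

definition gam :: "real \<Rightarrow> real \<Rightarrow> real \<Rightarrow> real \<Rightarrow> nat \<Rightarrow> real" where
  "gam K \<rho> \<delta>\<^sub>2 \<theta> T =
    (if \<theta> = 1/2 then 64 * K\<^sup>2
     else if \<theta> \<le> 1 then
       8 * max ((4 * \<theta>) powr \<theta> * exp 1 * K * \<rho>)
               (4 * (4 * \<theta>) powr (2 * \<theta>) * (exp 1)\<^sup>2 * K\<^sup>2)
     else
       8 * max (2 * ln (2 * real T / \<delta>\<^sub>2) powr (\<theta> - 1) * K * \<rho>)
               (4 * ((2 powr (2 * \<theta> + 1) + 2) * Gamma (2 * \<theta> + 1)
                      + 2 powr (3 * \<theta>) * Gamma (3 * \<theta> + 1)
                          / (3 * ln (2 * real T / \<delta>\<^sub>2) powr (\<theta> - 1))) * K\<^sup>2))"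

text \<open>Here \<open>\<Delta>\<close> is the initial optimality gap.\<close>

definition sgd_bound ::
    "real \<Rightarrow> real \<Rightarrow> real \<Rightarrow> real \<Rightarrow> real \<Rightarrow> real \<Rightarrow> real \<Rightarrow> real \<Rightarrow> real \<Rightarrow> nat \<Rightarrow> real" where
  "sgd_bound L c K \<rho> \<theta> \<Delta> \<delta>\<^sub>1 \<delta>\<^sub>2 \<delta>\<^sub>3 T =
     4 * \<Delta> / (c * sqrt (real T))
     + gam K \<rho> \<delta>\<^sub>2 \<theta> T * ln (1 / \<delta>\<^sub>3) / sqrt (real T)
     + 4 * L * K\<^sup>2 * c * (4 * exp 1 * \<theta> * ln (2 / \<delta>\<^sub>1)) powr (2 * \<theta>) * ln (real T + 1)
         / sqrt (real T)"

text \<open>For comparison functions that are eventually positive, the library's \<open>O\<close> is finiteness of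
  the limit superior of the quotients.\<close>

lemma bigo_iff_limsup:
  fixes a b :: "nat \<Rightarrow> real"
  assumes pos: "eventually (\<lambda>T. b T > 0) sequentially"
  shows "a \<in> O(b) \<longleftrightarrow> limsup (\<lambda>T. ereal (\<bar>a T\<bar> / b T)) < \<infinity>"
proof
  assume "a \<in> O(b)"
  then obtain C where "eventually (\<lambda>T. norm (a T) \<le> C * norm (b T)) sequentially"
    by (elim landau_o.bigE)
  with pos have "eventually (\<lambda>T. ereal (\<bar>a T\<bar> / b T) \<le> ereal C) sequentially"
    by eventually_elim (simp add: divide_le_eq)
  then have "limsup (\<lambda>T. ereal (\<bar>a T\<bar> / b T)) \<le> ereal C" by (rule Limsup_bounded)
  then show "limsup (\<lambda>T. ereal (\<bar>a T\<bar> / b T)) < \<infinity>" by (rule le_less_trans) simp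
next
  assume "limsup (\<lambda>T. ereal (\<bar>a T\<bar> / b T)) < \<infinity>"
  then obtain C where C: "limsup (\<lambda>T. ereal (\<bar>a T\<bar> / b T)) < ereal C"
    using ereal_dense2 by blast
  have "eventually (\<lambda>T. ereal (\<bar>a T\<bar> / b T) < ereal C) sequentially"
    using C by (rule Limsup_lessD)
  with pos have "eventually (\<lambda>T. norm (a T) \<le> C * norm (b T)) sequentially"
    by eventually_elim (simp add: divide_less_eq)
  then show "a \<in> O(b)" by (rule bigoI)
qed

end

theory Submission
  imports Defs
begin

text \<open>The quadratic upper bound of an \<open>L\<close>-smooth function, applied to each step and summed, gives
  with \<open>G\<^sub>t = grad f (x\<^sub>t)\<close>, \<open>a\<^sub>t = 1 / sqrt (t + 1)\<close> and \<open>u\<^sub>t = 1 - L \<eta>\<^sub>t \<in> [0, 1]\<close>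
  (\<open>sgd_sum_decrease\<close>)

  \<open>\<Sum> a\<^sub>t |G\<^sub>t|\<^sup>2 \<le> 4 (f x\<^sub>0 - f\<^sup>*) / c + \<Sum> a\<^sub>t (4 u\<^sub>t \<langle>G\<^sub>t, e\<^sub>t\<rangle> - |G\<^sub>t|\<^sup>2) + 2 L c \<Sum> |e\<^sub>t|\<^sup>2 / (t + 1)\<close>.

  The three summands on the right are the three terms of the bound. The point is that half of the
  descent has been kept back as \<open>- a\<^sub>t |G\<^sub>t|\<^sup>2\<close>, which compensates the variance of the
  martingale difference \<open>4 a\<^sub>t u\<^sub>t \<langle>G\<^sub>t, e\<^sub>t\<rangle>\<close>: this difference is linear in \<open>G\<^sub>t\<close>, so its conditional
  variance is quadratic in \<open>G\<^sub>t\<close>.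

  The last sum is controlled by moments. A variable \<open>Y\<close> with \<open>E exp (Y\<^bsup>1/\<theta>\<^esup>) \<le> 2\<close> has
  \<open>E Y\<^bsup>2p\<^esup> \<le> 2 (2 \<theta> p / e)\<^bsup>2 \<theta> p\<^esup>\<close>, a convex combination of such squares obeys the
  same moment bound, and Markov's inequality with \<open>p\<close> proportional to \<open>ln (2 / \<delta>\<^sub>1)\<close> gives the claim
  (\<open>weighted_sum_sub_Weibull_tail\<close>). The weights \<open>1 / (t + 1)\<close> add up to at most \<open>2 ln (T + 1)\<close>.

  For the middle sum, put \<open>\<lambda> = 1 / \<gamma>(\<theta>)\<close>. The products of
  \<open>exp (\<lambda> a\<^sub>t (4 u\<^sub>t \<langle>G\<^sub>t, e\<^sub>t\<rangle> - |G\<^sub>t|\<^sup>2))\<close> form a supermartingale, so that Markov's inequality bounds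
  the sum by \<open>\<gamma>(\<theta>) ln (1 / \<delta>\<^sub>3)\<close> with probability \<open>1 - \<delta>\<^sub>3\<close>. The supermartingale property rests on a
  deterministic inequality (\<open>gam_dominates\<close>) whose first-order term is linear in the noise:

  \<open>exp v \<le> 1 + v + h(s) exp (y\<^bsup>1/\<theta>\<^esup>)\<close> whenever \<open>|v| \<le> s y\<close>, with \<open>1 + 2 h(s) \<le> exp (C s\<^sup>2)\<close>.

  Taking conditional expectations with \<open>v = 4 \<lambda> a\<^sub>t u\<^sub>t \<langle>G\<^sub>t, e\<^sub>t\<rangle>\<close>, \<open>y = |e\<^sub>t| / K\<close> and
  \<open>s = 4 \<lambda> a\<^sub>t u\<^sub>t K |G\<^sub>t|\<close>, the linear term vanishes and \<open>\<gamma>(\<theta>) \<ge> 16 C K\<^sup>2\<close> makes \<open>C s\<^sup>2 \<le> \<lambda> a\<^sub>t |G\<^sub>t|\<^sup>2\<close>.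
  For \<open>\<theta> = 1/2\<close> the inequality holds for every \<open>s\<close>. For \<open>1/2 < \<theta> \<le> 1\<close> it needs \<open>s\<close> to be small, which
  is what \<open>|G\<^sub>t| \<le> \<rho>\<close> and the first entry of the maximum in \<open>\<gamma>(\<theta>)\<close> are for. For \<open>\<theta> > 1\<close> exponential
  moments of \<open>y\<close> need not exist, and besides a small \<open>s\<close> the inequality needs
  \<open>y \<le> ln (2 T / \<delta>\<^sub>2)\<^bsup>\<theta>\<^esup>\<close>; that some noise vector exceeds this
  level before time \<open>T\<close> has probability at most \<open>\<delta>\<^sub>2\<close>. Outside the allowed
  range the exponential is replaced by \<open>0\<close>, which keeps the inequality (\<open>Taylor2_dominated\<close>) and
  thus the supermartingale.\<close>

section \<open>Elementary inequalities\<close>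

text \<open>Young's inequality for \<open>u = (u\<^bsup>p\<^esup>)\<^bsup>1/p\<^esup> 1\<^bsup>1 - 1/p\<^esup>\<close>.\<close>

lemma Bernoulli_inequality_powr:
  fixes u p :: real
  assumes "u \<ge> 0" "p \<ge> 1"
  shows "1 + p * (u - 1) \<le> u powr p"
proof (cases "u = 0")
  case False
  then have u: "u > 0" using assms by simp
  have "(u powr p) powr (1 / p) * 1 powr (1 - 1 / p) \<le> 1 / p * u powr p + (1 - 1 / p) * 1"
    using u assms by (intro Youngs_inequality_0) auto
  then have "u \<le> 1 / p * u powr p + (1 - 1 / p)"
    using u assms by (simp add: powr_powr)
  then have "p * u \<le> p * (1 / p * u powr p + (1 - 1 / p))"
    using assms by (intro mult_left_mono) auto
  also have "\<dots> = u powr p + p - 1" using assms by (simp add: field_simps)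
  finally show ?thesis by (simp add: algebra_simps)
qed (use assms in simp)

text \<open>The left-hand side is \<open>\<integral> v\<^bsup>a\<^esup> exp (- t) dt\<close> over \<open>t \<ge> v\<close>, hence at most the part of
  Euler's integral beyond \<open>v\<close>.\<close>

lemma powr_exp_minus_le_Gamma:
  fixes a v :: real
  assumes a: "a > 0" and v: "v \<ge> 0"
  shows "v powr a * exp (- v) \<le> Gamma (a + 1)"
proof -
  have 1: "((\<lambda>t. t powr a / exp t) has_integral Gamma (a + 1)) {0..}"
    using Gamma_integral_real[of "a + 1"] a by simp
  have "((\<lambda>t::real. exp (- 1 * t)) has_integral exp (- 1 * v) / 1) {v..}"
    by (rule has_integral_exp_minus_to_infinity) simp
  then have "((\<lambda>t. exp (- t)) has_integral exp (- v)) {v..}" by simp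
  then have "((\<lambda>t. v powr a * exp (- t)) has_integral v powr a * exp (- v)) {v..}"
    by (rule has_integral_mult_right)
  then have 2: "((\<lambda>t. if t \<in> {v..} then v powr a * exp (- t) else 0)
      has_integral v powr a * exp (- v)) {0..}"
    using v by (subst has_integral_restrict) auto
  show ?thesis
  proof (rule has_integral_le[OF 2 1])
    fix t :: real assume "t \<in> {0..}"
    then show "(if t \<in> {v..} then v powr a * exp (- t) else 0) \<le> t powr a / exp t"
      using v a by (auto simp: exp_minus divide_inverse intro!: mult_right_mono powr_mono2)
  qed
qed

text \<open>Equality holds at \<open>v = a\<close>, where \<open>v\<^bsup>a\<^esup> exp (- v)\<close> has its maximum; this is
  the source of the powers \<open>(2 \<theta> p / e)\<^bsup>2 \<theta> p\<^esup>\<close> in sub-Weibull moments.\<close>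

lemma powr_exp_minus_le:
  fixes a v :: real
  assumes a: "a > 0" and v: "v \<ge> 0"
  shows "v powr a \<le> (a / exp 1) powr a * exp v"
proof -
  have "v / a \<le> exp (v / a - 1)" using exp_ge_add_one_self[of "v / a - 1"] by simp
  then have "(v / a) powr a \<le> exp (v / a - 1) powr a"
    using a v by (intro powr_mono2) auto
  also have "\<dots> = exp (v - a)" using a by (simp add: powr_def field_simps)
  finally have "a powr a * (v / a) powr a \<le> a powr a * exp (v - a)"
    by (intro mult_left_mono) auto
  moreover have "a powr a * (v / a) powr a = v powr a"
    using a v by (simp add: powr_divide)
  moreover have "a powr a * exp (v - a) = (a / exp 1) powr a * exp v"
    using a by (simp add: powr_divide exp_diff) (simp add: powr_def)
  ultimately show ?thesis by simp
qed

lemma exp_le_taylor2: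
  fixes x y :: real
  assumes "x \<le> y" "0 \<le> y"
  shows "exp x \<le> 1 + x + x\<^sup>2 / 2 * exp y"
proof (cases "x = 0")
  case False
  obtain t where t: "\<bar>t\<bar> \<le> \<bar>x\<bar>" and tx: "t \<le> max 0 x"
    and e: "exp x = (\<Sum>m<2. x ^ m / fact m) + exp t / fact 2 * x ^ 2"
  proof (cases "x > 0")
    case True
    obtain t where "0 < t" "t < x" "exp x = (\<Sum>m<2. exp 0 / fact m * x ^ m) + exp t / fact 2 * x ^ 2"
      using Maclaurin[of x 2 "\<lambda>m. exp" exp] True by (auto intro: DERIV_exp)
    then show ?thesis using that[of t] by auto
  next
    case F: False
    then have "x < 0" using False by simp
    then obtain t where "x < t" "t < 0" "exp x = (\<Sum>m<2. exp 0 / fact m * x ^ m) + exp t / fact 2 * x ^ 2"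
      using Maclaurin_minus[of x 2 "\<lambda>m. exp" exp] by (auto intro: DERIV_exp)
    then show ?thesis using that[of t] by auto
  qed
  have "exp t * (x\<^sup>2 / 2) \<le> exp y * (x\<^sup>2 / 2)" using tx assms
    by (intro mult_right_mono) auto
  then show ?thesis using e by (simp add: numeral_2_eq_2 mult.commute)
qed (use assms in auto)

lemma two_le_exp_1: "2 \<le> exp (1::real)"
  using exp_ge_add_one_self[of "1::real"] by simp

text \<open>A second-order remainder that is dominated by \<open>h\<close> also covers the value \<open>0\<close>: since
  \<open>1 + x + x\<^sup>2 / 2 > 0\<close> for all \<open>x\<close>, replacing the exponential by \<open>0\<close> is harmless even when \<open>1 + x\<close> is
  very negative.\<close>

lemma Taylor2_dominated:
  fixes x s y h :: real
  assumes "\<bar>x\<bar> \<le> s * y"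
    and ok: "ok \<Longrightarrow> (s * y)\<^sup>2 / 2 * exp (s * y) \<le> h"
    and not_ok: "(s * y)\<^sup>2 / 2 \<le> h"
  shows "(if ok then exp x else 0) \<le> 1 + x + h"
proof (cases ok)
  case True
  have "exp x \<le> 1 + x + x\<^sup>2 / 2 * exp (s * y)"
    using assms(1) by (intro exp_le_taylor2) auto
  moreover have "x\<^sup>2 / 2 * exp (s * y) \<le> (s * y)\<^sup>2 / 2 * exp (s * y)"
    using assms(1) abs_le_square_iff[of x "s*y"] by simp
  moreover note ok[OF True]
  ultimately have "exp x \<le> 1 + x + h" by linarith
  then show ?thesis using True by simp
next
  case False
  have "x\<^sup>2 \<le> (s * y)\<^sup>2" using assms(1) abs_le_square_iff[of x "s*y"] by simp
  then have "0 \<le> 1 + x + (s * y)\<^sup>2 / 2"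
    using zero_le_power2[of "x + 1"] by (simp add: power2_eq_square algebra_simps)
  then show ?thesis using False not_ok by simp
qed

section \<open>Domination of the exponential by a sub-Weibull weight\<close>

definition tail_cutoff :: "real \<Rightarrow> real \<Rightarrow> nat \<Rightarrow> real" where
  "tail_cutoff \<delta>\<^sub>2 \<theta> T = ln (2 * real T / \<delta>\<^sub>2) powr \<theta>"

lemma ln_two_T_pos:
  assumes "T \<ge> 1" "\<delta>\<^sub>2 \<in> {0<..<1}"
  shows "0 < ln (2 * real T / \<delta>\<^sub>2)"
proof -
  have "1 < 2 * real T / \<delta>\<^sub>2" using assms by (simp add: field_simps)
  then show ?thesis by simp
qed

text \<open>Here and below \<open>y\<close> stands for the normalised noise and \<open>s y\<close> for a bound on the exponent.
  The inequality \<open>s y \<le> s\<^sup>2 / 2 + y\<^sup>2 / 2\<close> leaves half of \<open>y\<^sup>2\<close> to absorb the factor in front, for every \<open>s\<close>.\<close>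

lemma domination_sub_Gaussian:
  fixes s y :: real
  assumes "0 \<le> s" "0 \<le> y"
  shows "(s * y)\<^sup>2 / 2 * exp (s * y) \<le> s\<^sup>2 / 2 * exp (s\<^sup>2 / 2) * exp (y\<^sup>2)"
proof -
  have "s * y \<le> s\<^sup>2 / 2 + y\<^sup>2 / 2"
    using zero_le_power2[of "s - y"] by (simp add: power2_eq_square algebra_simps)
  then have 1: "exp (s * y) \<le> exp (s\<^sup>2 / 2) * exp (y\<^sup>2 / 2)" by (simp flip: exp_add)
  have "0 \<le> (y\<^sup>2 / 2 - 1)\<^sup>2 + 1" by (intro add_nonneg_nonneg) auto
  then have "y\<^sup>2 \<le> 1 + y\<^sup>2 / 2 + (y\<^sup>2 / 2)\<^sup>2 / 2"
    by (simp add: power2_eq_square field_simps)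
  also have "\<dots> \<le> exp (y\<^sup>2 / 2)" by (rule exp_lower_Taylor_quadratic) simp
  finally have 2: "y\<^sup>2 \<le> exp (y\<^sup>2 / 2)" .
  have "(s * y)\<^sup>2 / 2 * exp (s * y) \<le> (s * y)\<^sup>2 / 2 * (exp (s\<^sup>2 / 2) * exp (y\<^sup>2 / 2))"
    using 1 by (intro mult_left_mono) auto
  also have "\<dots> = s\<^sup>2 / 2 * exp (s\<^sup>2 / 2) * (y\<^sup>2 * exp (y\<^sup>2 / 2))"
    by (simp add: power_mult_distrib)
  also have "\<dots> \<le> s\<^sup>2 / 2 * exp (s\<^sup>2 / 2) * (exp (y\<^sup>2 / 2) * exp (y\<^sup>2 / 2))"
    using 2 by (intro mult_left_mono mult_right_mono) auto
  also have "exp (y\<^sup>2 / 2) * exp (y\<^sup>2 / 2) = exp (y\<^sup>2)" by (simp flip: exp_add)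
  finally show ?thesis .
qed

text \<open>For \<open>\<theta> \<le> 1\<close> the weight dominates \<open>exp y\<close> up to the factor \<open>e\<close>, so a small \<open>s\<close> leaves enough of it for
  the quadratic factor.\<close>

lemma domination_light_tail:
  fixes s y \<theta> :: real
  assumes "0 \<le> s" "s \<le> 1 / 4" "0 \<le> y" "0 < \<theta>" "\<theta> \<le> 1"
  shows "(s * y)\<^sup>2 / 2 * exp (s * y) \<le> 4 * exp 1 * s\<^sup>2 * exp (y powr (1 / \<theta>))"
proof -
  have "(y / 2)\<^sup>2 / 2 \<le> exp (y / 2)" using exp_lower_Taylor_quadratic[of "y / 2"] assms by simp
  then have 1: "y\<^sup>2 / 2 \<le> 4 * exp (y / 2)" by (simp add: power2_eq_square)
  have 2: "y \<le> 1 + y powr (1 / \<theta>)"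
  proof (cases "y \<le> 1")
    case False
    then have "y powr 1 \<le> y powr (1 / \<theta>)" using assms by (intro powr_mono) auto
    then show ?thesis using False by simp
  qed (simp add: add_increasing2)
  have "s * y \<le> 1/4 * y" using assms by (intro mult_right_mono) auto
  then have 3: "exp (s * y) \<le> exp (y / 2)" using assms by simp
  have "(s * y)\<^sup>2 / 2 * exp (s * y) = s\<^sup>2 * (y\<^sup>2 / 2 * exp (s * y))" by (simp add: power_mult_distrib)
  also have "\<dots> \<le> s\<^sup>2 * (4 * exp (y / 2) * exp (y / 2))"
    using 1 3 by (intro mult_left_mono mult_mono) auto
  also have "\<dots> = 4 * s\<^sup>2 * exp y" by (simp flip: exp_add)
  also have "\<dots> \<le> 4 * s\<^sup>2 * (exp 1 * exp (y powr (1 / \<theta>)))"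
    using 2 by (intro mult_left_mono) (auto simp flip: exp_add)
  finally show ?thesis by (simp add: algebra_simps)
qed

lemma square_le_Gamma_exp:
  fixes y \<theta> :: real
  assumes "0 \<le> y" "0 < \<theta>"
  shows "y\<^sup>2 \<le> 2 powr (2 * \<theta>) * Gamma (2 * \<theta> + 1) * exp (y powr (1 / \<theta>) / 2)"
proof -
  define V where "V = y powr (1 / \<theta>)"
  have V: "V \<ge> 0" and y: "y = V powr \<theta>" using assms by (auto simp: V_def powr_powr)
  have "(V / 2) powr (2 * \<theta>) * exp (- (V / 2)) \<le> Gamma (2 * \<theta> + 1)"
    using V assms by (intro powr_exp_minus_le_Gamma) auto
  then have *: "(V / 2) powr (2 * \<theta>) \<le> Gamma (2 * \<theta> + 1) * exp (V / 2)"
    by (simp add: exp_minus field_simps)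
  have "y\<^sup>2 = V powr (2 * \<theta>)" unfolding y power2_eq_square
    by (simp flip: powr_add)
  also have "\<dots> = 2 powr (2 * \<theta>) * (V / 2) powr (2 * \<theta>)" using V by (simp add: powr_divide)
  also have "\<dots> \<le> 2 powr (2 * \<theta>) * (Gamma (2 * \<theta> + 1) * exp (V / 2))"
    using * by (intro mult_left_mono) auto
  finally show ?thesis by (simp add: V_def mult.assoc)
qed

text \<open>Below the level \<open>b\<^bsup>\<theta>\<^esup>\<close> the exponent is small compared with \<open>V = y\<^bsup>1/\<theta>\<^esup>\<close>, because
  \<open>s y = s V V\<^bsup>\<theta> - 1\<^esup> \<le> s V b\<^bsup>\<theta> - 1\<^esup> \<le> V / 4\<close>.\<close>

lemma domination_truncated:
  fixes s y b \<theta> :: real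
  assumes s: "0 \<le> s" "s * (4 * b powr (\<theta> - 1)) \<le> 1" and y: "0 \<le> y" "y \<le> b powr \<theta>"
    and \<theta>: "1 < \<theta>" and b: "0 < b"
  shows "(s * y)\<^sup>2 / 2 * exp (s * y)
    \<le> 2 powr (2 * \<theta>) / 2 * Gamma (2 * \<theta> + 1) * s\<^sup>2 * exp (y powr (1 / \<theta>))"
proof -
  define V where "V = y powr (1 / \<theta>)"
  have V: "V \<ge> 0" and yV: "y = V powr \<theta>" using y \<theta> by (auto simp: V_def powr_powr)
  have "V \<le> (b powr \<theta>) powr (1 / \<theta>)" unfolding V_def
    using y \<theta> by (intro powr_mono2) auto
  then have Vb: "V \<le> b" using b \<theta> by (simp add: powr_powr)
  have "s * y \<le> V / 4"
  proof -
    have "y = V * V powr (\<theta> - 1)" unfolding yV using V by (cases "V = 0") (auto simp: powr_diff)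
    also have "\<dots> \<le> V * b powr (\<theta> - 1)" using V Vb \<theta> by (intro mult_left_mono powr_mono2) auto
    finally have "s * y \<le> s * (V * b powr (\<theta> - 1))" using s by (intro mult_left_mono) auto
    also have "\<dots> = V / 4 * (s * (4 * b powr (\<theta> - 1)))" by simp
    also have "\<dots> \<le> V / 4 * 1" using s V by (intro mult_left_mono) auto
    finally show ?thesis by simp
  qed
  then have 1: "exp (s * y) \<le> exp (V / 2)" using V by simp
  have "(s * y)\<^sup>2 / 2 * exp (s * y) = s\<^sup>2 / 2 * (y\<^sup>2 * exp (s * y))" by (simp add: power_mult_distrib)
  also have "\<dots> \<le> s\<^sup>2 / 2 * (2 powr (2 * \<theta>) * Gamma (2 * \<theta> + 1) * exp (V / 2) * exp (V / 2))"
    using 1 square_le_Gamma_exp[of y \<theta>] y \<theta> unfolding V_def[symmetric]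
    by (intro mult_left_mono mult_mono) (auto intro!: mult_nonneg_nonneg Gamma_real_nonneg)
  also have "\<dots> = 2 powr (2 * \<theta>) / 2 * Gamma (2 * \<theta> + 1) * s\<^sup>2 * (exp (V / 2) * exp (V / 2))"
    by simp
  also have "exp (V / 2) * exp (V / 2) = exp V" by (simp flip: exp_add)
  finally show ?thesis by (simp add: V_def)
qed

text \<open>What the martingale estimate asks of \<open>\<gamma>(\<theta>)\<close>. If \<open>\<theta> > 1/2\<close>, the second entry of its maximum bounds the
  variance proxy \<open>16 C K\<^sup>2\<close>, and the first one turns a bound \<open>s \<gamma>(\<theta>) \<le> 4 K \<rho>\<close> into the smallness of \<open>s\<close>
  that the domination lemmas ask for.\<close>

lemma gam_dominates:
  assumes \<theta>: "\<theta> \<ge> 1/2" and K: "K > 0" and \<rho>: "\<theta> > 1/2 \<Longrightarrow> \<rho> \<ge> 0"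
    and T: "T \<ge> 1" and \<delta>\<^sub>2: "\<delta>\<^sub>2 \<in> {0<..<1}"
  obtains C :: real and h :: "real \<Rightarrow> real"
  where "h \<in> borel_measurable borel" "\<And>s. 0 \<le> h s" "\<And>s. 1 + 2 * h s \<le> exp (C * s\<^sup>2)"
    "C > 0" "16 * C * K\<^sup>2 \<le> gam K \<rho> \<delta>\<^sub>2 \<theta> T"
    "\<And>s x y. \<lbrakk>0 \<le> s; 0 \<le> y; \<bar>x\<bar> \<le> s * y; \<theta> > 1/2 \<Longrightarrow> s * gam K \<rho> \<delta>\<^sub>2 \<theta> T \<le> 4 * K * \<rho>\<rbrakk> \<Longrightarrow>
       (if \<theta> \<le> 1 \<or> y \<le> tail_cutoff \<delta>\<^sub>2 \<theta> T then exp x else 0)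
         \<le> 1 + x + h s * exp (y powr (1 / \<theta>))"
proof -
  consider "\<theta> = 1/2" | "1/2 < \<theta>" "\<theta> \<le> 1" | "1 < \<theta>" using \<theta> by linarith
  then show ?thesis
  proof cases
    case 1
    show ?thesis
    proof (rule that[where C = 4 and h = "\<lambda>s. s\<^sup>2 / 2 * exp (s\<^sup>2 / 2)"])
      show "1 + 2 * (s\<^sup>2 / 2 * exp (s\<^sup>2 / 2)) \<le> exp (4 * s\<^sup>2)" for s :: real
      proof -
        have "1 + 2 * (s\<^sup>2 / 2 * exp (s\<^sup>2 / 2)) \<le> (1 + s\<^sup>2) * exp (s\<^sup>2 / 2)"
          by (simp add: algebra_simps)
        also have "\<dots> \<le> exp (s\<^sup>2) * exp (s\<^sup>2 / 2)"
          using exp_ge_add_one_self[of "s\<^sup>2"] by (intro mult_right_mono) auto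
        also have "\<dots> \<le> exp (4 * s\<^sup>2)" by (simp flip: exp_add)
        finally show ?thesis .
      qed
      show "16 * 4 * K\<^sup>2 \<le> gam K \<rho> \<delta>\<^sub>2 \<theta> T" using 1 by (simp add: gam_def)
    next
      fix s x y :: real
      assume *: "0 \<le> s" "0 \<le> y" "\<bar>x\<bar> \<le> s * y"
      have d: "(s * y)\<^sup>2 / 2 * exp (s * y) \<le> s\<^sup>2 / 2 * exp (s\<^sup>2 / 2) * exp (y\<^sup>2)"
        using domination_sub_Gaussian * by blast
      have "y powr (1 / \<theta>) = y powr 2" unfolding 1 by simp
      also have "\<dots> = y\<^sup>2" using *(2) by simp
      finally have "y powr (1 / \<theta>) = y\<^sup>2" .
      moreover have "(s * y)\<^sup>2 / 2 \<le> (s * y)\<^sup>2 / 2 * exp (s * y)"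
        using * by (intro mult_le_cancel_left1[THEN iffD2]) auto
      ultimately show "(if \<theta> \<le> 1 \<or> y \<le> tail_cutoff \<delta>\<^sub>2 \<theta> T then exp x else 0)
         \<le> 1 + x + s\<^sup>2 / 2 * exp (s\<^sup>2 / 2) * exp (y powr (1 / \<theta>))"
        using d by (intro Taylor2_dominated[OF *(3)]) auto
    qed auto
  next
    case 2
    \<comment> \<open>\<open>C = 2 D\<close> exhausts the second entry of the maximum; the light-tail bound asks for \<open>D \<ge> 4 e\<close>.\<close>
    define D where "D = (4 * \<theta>) powr (2 * \<theta>) * (exp 1)\<^sup>2"
    have p2: "2 \<le> (4 * \<theta>) powr (2 * \<theta>)"
    proof -
      have "2 = (2::real) powr 1" by simp
      also have "\<dots> \<le> 2 powr (2 * \<theta>)" using 2 by (intro powr_mono) auto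
      also have "\<dots> \<le> (4 * \<theta>) powr (2 * \<theta>)" using 2 by (intro powr_mono2) auto
      finally show ?thesis .
    qed
    have p1: "1 \<le> (4 * \<theta>) powr \<theta>" using 2 by (intro ge_one_powr_ge_zero) auto
    have g: "gam K \<rho> \<delta>\<^sub>2 \<theta> T = 8 * max ((4 * \<theta>) powr \<theta> * exp 1 * K * \<rho>)
               (4 * (4 * \<theta>) powr (2 * \<theta>) * (exp 1)\<^sup>2 * K\<^sup>2)"
      using 2 by (simp add: gam_def)
    have D: "4 * exp 1 \<le> D" "D > 0"
    proof -
      have "4 * exp 1 \<le> 2 * (exp 1 * exp (1::real))" using two_le_exp_1 by simp
      also have "\<dots> \<le> (4 * \<theta>) powr (2 * \<theta>) * (exp 1 * exp 1)" using p2 by (intro mult_right_mono) auto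
      finally show "4 * exp 1 \<le> D" by (simp add: D_def power2_eq_square)
      then show "D > 0" using exp_gt_zero[of "1::real"] by linarith
    qed
    show ?thesis
    proof (rule that[where C = "2 * D" and h = "\<lambda>s. D * s\<^sup>2"])
      show "1 + 2 * (D * s\<^sup>2) \<le> exp (2 * D * s\<^sup>2)" for s :: real
        using exp_ge_add_one_self[of "2 * D * s\<^sup>2"] by (simp only: mult.assoc)
      have "16 * (2 * D) * K\<^sup>2 = 8 * (4 * (4 * \<theta>) powr (2 * \<theta>) * (exp 1)\<^sup>2 * K\<^sup>2)"
        by (simp add: D_def)
      also have "\<dots> \<le> gam K \<rho> \<delta>\<^sub>2 \<theta> T" unfolding g by (intro mult_left_mono max.cobounded2) simp
      finally show C: "16 * (2 * D) * K\<^sup>2 \<le> gam K \<rho> \<delta>\<^sub>2 \<theta> T" .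
      fix s x y :: real
      assume *: "0 \<le> s" "0 \<le> y" "\<bar>x\<bar> \<le> s * y" and s: "\<theta> > 1/2 \<Longrightarrow> s * gam K \<rho> \<delta>\<^sub>2 \<theta> T \<le> 4 * K * \<rho>"
      have gpos: "0 < gam K \<rho> \<delta>\<^sub>2 \<theta> T" 
        using D K by (intro less_le_trans[OF _ C]) auto
      have "s \<le> 1 / 4"
      proof -
        have "2 * (K * \<rho>) \<le> (4 * \<theta>) powr \<theta> * exp 1 * (K * \<rho>)"
          using mult_mono[OF p1 two_le_exp_1] K \<rho> 2 by (intro mult_right_mono) auto
        then have "16 * (K * \<rho>) \<le> 8 * ((4 * \<theta>) powr \<theta> * exp 1 * K * \<rho>)"
          unfolding mult.assoc by linarith
        also have "\<dots> \<le> gam K \<rho> \<delta>\<^sub>2 \<theta> T" unfolding g by (intro mult_left_mono max.cobounded1) simp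
        finally have "16 * (K * \<rho>) \<le> gam K \<rho> \<delta>\<^sub>2 \<theta> T" .
        then have "s * gam K \<rho> \<delta>\<^sub>2 \<theta> T \<le> 1/4 * gam K \<rho> \<delta>\<^sub>2 \<theta> T" using s 2 by simp
        then show ?thesis using gpos by simp
      qed
      then have "(s * y)\<^sup>2 / 2 * exp (s * y) \<le> 4 * exp 1 * s\<^sup>2 * exp (y powr (1 / \<theta>))"
        using * 2 by (intro domination_light_tail) auto
      also have "\<dots> \<le> D * s\<^sup>2 * exp (y powr (1 / \<theta>))" using D by (intro mult_right_mono) auto
      finally have d: "(s * y)\<^sup>2 / 2 * exp (s * y) \<le> D * s\<^sup>2 * exp (y powr (1 / \<theta>))" .
      moreover have "(s * y)\<^sup>2 / 2 \<le> (s * y)\<^sup>2 / 2 * exp (s * y)"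
        using * by (intro mult_le_cancel_left1[THEN iffD2]) auto
      ultimately show "(if \<theta> \<le> 1 \<or> y \<le> tail_cutoff \<delta>\<^sub>2 \<theta> T then exp x else 0)
         \<le> 1 + x + D * s\<^sup>2 * exp (y powr (1 / \<theta>))"
        by (intro Taylor2_dominated[OF *(3)]) auto
    qed (use D in auto)
  next
    case 3
    define b where "b = ln (2 * real T / \<delta>\<^sub>2)"
    have b: "b > 0" unfolding b_def using ln_two_T_pos T \<delta>\<^sub>2 by blast
    have Gam: "Gamma (2 * \<theta> + 1) > 0" "Gamma (3 * \<theta> + 1) > 0" using 3 by (auto intro: Gamma_real_pos)
    define D where "D = (2 powr (2 * \<theta> + 1) + 2) * Gamma (2 * \<theta> + 1)"
    have D: "D > 0" unfolding D_def using Gam by (intro mult_pos_pos add_pos_pos) auto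
    define R where "R = 2 powr (3 * \<theta>) * Gamma (3 * \<theta> + 1) / (3 * b powr (\<theta> - 1))"
    have R: "R \<ge> 0" unfolding R_def using Gam by simp
    have g: "gam K \<rho> \<delta>\<^sub>2 \<theta> T = 8 * max (2 * b powr (\<theta> - 1) * K * \<rho>) (4 * (D + R) * K\<^sup>2)"
      using 3 by (simp add: gam_def b_def D_def R_def)
    have DD: "2 powr (2 * \<theta>) / 2 * Gamma (2 * \<theta> + 1) \<le> D"
    proof -
      have "(0::real) \<le> 2 powr (2 * \<theta>)" "2 powr (2 * \<theta> + 1) = 2 powr (2 * \<theta>) * (2::real)"
        by (simp_all add: powr_add)
      then have "2 powr (2 * \<theta>) / 2 \<le> 2 powr (2 * \<theta> + 1) + (2::real)" by linarith
      then show ?thesis unfolding D_def using Gam by (intro mult_right_mono) auto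
    qed
    show ?thesis
    proof (rule that[where C = "2 * D" and h = "\<lambda>s. D * s\<^sup>2"])
      show "1 + 2 * (D * s\<^sup>2) \<le> exp (2 * D * s\<^sup>2)" for s :: real
        using exp_ge_add_one_self[of "2 * D * s\<^sup>2"] by (simp only: mult.assoc)
      have "16 * (2 * D) * K\<^sup>2 \<le> 32 * (D + R) * K\<^sup>2" using R by (intro mult_right_mono) auto
      also have "\<dots> = 8 * (4 * (D + R) * K\<^sup>2)" by simp
      also have "\<dots> \<le> gam K \<rho> \<delta>\<^sub>2 \<theta> T" unfolding g by (intro mult_left_mono max.cobounded2) simp
      finally show C: "16 * (2 * D) * K\<^sup>2 \<le> gam K \<rho> \<delta>\<^sub>2 \<theta> T" .
      fix s x y :: real
      assume *: "0 \<le> s" "0 \<le> y" "\<bar>x\<bar> \<le> s * y" and s: "\<theta> > 1/2 \<Longrightarrow> s * gam K \<rho> \<delta>\<^sub>2 \<theta> T \<le> 4 * K * \<rho>"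
      have gpos: "0 < gam K \<rho> \<delta>\<^sub>2 \<theta> T" 
        using D K by (intro less_le_trans[OF _ C]) auto
      have sb: "s * (4 * b powr (\<theta> - 1)) \<le> 1"
      proof -
        have "s * gam K \<rho> \<delta>\<^sub>2 \<theta> T \<le> 4 * K * \<rho>" using s 3 by simp
        then have "s * gam K \<rho> \<delta>\<^sub>2 \<theta> T * (4 * b powr (\<theta> - 1)) \<le> 4 * K * \<rho> * (4 * b powr (\<theta> - 1))"
          by (rule mult_right_mono) simp
        also have "\<dots> = 8 * (2 * b powr (\<theta> - 1) * K * \<rho>)" by simp
        also have "\<dots> \<le> gam K \<rho> \<delta>\<^sub>2 \<theta> T" unfolding g by (intro mult_left_mono max.cobounded1) simp
        finally have "gam K \<rho> \<delta>\<^sub>2 \<theta> T * (s * (4 * b powr (\<theta> - 1))) \<le> gam K \<rho> \<delta>\<^sub>2 \<theta> T * 1"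
          by (simp add: mult_ac)
        then show ?thesis using gpos by (simp only: mult_le_cancel_left_pos)
      qed
      have d: "(s * y)\<^sup>2 / 2 * exp (s * y) \<le> D * s\<^sup>2 * exp (y powr (1 / \<theta>))" if "y \<le> b powr \<theta>"
      proof -
        have "(s * y)\<^sup>2 / 2 * exp (s * y) \<le> 2 powr (2 * \<theta>) / 2 * Gamma (2 * \<theta> + 1) * s\<^sup>2 * exp (y powr (1 / \<theta>))"
          using * sb that 3 b by (intro domination_truncated) auto
        also have "\<dots> \<le> D * s\<^sup>2 * exp (y powr (1 / \<theta>))" using DD by (intro mult_right_mono) auto
        finally show ?thesis .
      qed
      have "y\<^sup>2 \<le> 2 powr (2 * \<theta>) * Gamma (2 * \<theta> + 1) * exp (y powr (1 / \<theta>) / 2)"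
        using * 3 by (intro square_le_Gamma_exp) auto
      also have "\<dots> \<le> 2 powr (2 * \<theta>) * Gamma (2 * \<theta> + 1) * exp (y powr (1 / \<theta>))"
        using Gam by (intro mult_left_mono) auto
      also have "\<dots> \<le> 2 * D * exp (y powr (1 / \<theta>))" using DD by (intro mult_right_mono) auto
      finally have "s\<^sup>2 / 2 * y\<^sup>2 \<le> s\<^sup>2 / 2 * (2 * D * exp (y powr (1 / \<theta>)))"
        by (intro mult_left_mono) auto
      then have "(s * y)\<^sup>2 / 2 \<le> D * s\<^sup>2 * exp (y powr (1 / \<theta>))"
        by (simp add: power_mult_distrib mult_ac)
      then show "(if \<theta> \<le> 1 \<or> y \<le> tail_cutoff \<delta>\<^sub>2 \<theta> T then exp x else 0)
         \<le> 1 + x + D * s\<^sup>2 * exp (y powr (1 / \<theta>))"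
        using d 3 by (intro Taylor2_dominated[OF *(3)]) (auto simp: tail_cutoff_def b_def)
    qed (use D in auto)
  qed
qed

section \<open>Smooth functions and the descent of a gradient step\<close>

lemma GDERIV_along_line:
  assumes "\<And>y. f differentiable (at y)"
  shows "((\<lambda>t::real. f (x + t *\<^sub>R d)) has_real_derivative (grad f (x + t *\<^sub>R d) \<bullet> d)) (at t)"
proof -
  have "(f has_derivative (\<lambda>h. h \<bullet> grad f (x + t *\<^sub>R d))) (at (x + t *\<^sub>R d))"
    using differentiable_imp_GDERIV_grad[OF assms] unfolding gderiv_def .
  moreover have "((\<lambda>t. x + t *\<^sub>R d) has_derivative (\<lambda>h. h *\<^sub>R d)) (at t)"
    by (auto intro!: derivative_eq_intros)
  ultimately have "((\<lambda>t. f (x + t *\<^sub>R d)) has_derivative (\<lambda>h. (h *\<^sub>R d) \<bullet> grad f (x + t *\<^sub>R d))) (at t)"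
    by (rule has_derivative_compose[rotated])
  then show ?thesis
    unfolding has_field_derivative_def by (simp add: inner_commute mult_commute_abs)
qed

text \<open>Along the segment, \<open>f\<close> minus the claimed quadratic has a nonpositive derivative by Cauchy-Schwarz
  and the Lipschitz bound on the gradient.\<close>

lemma smooth_quadratic_upper_bound:
  assumes diff: "\<And>y. f differentiable (at y)" and smooth: "smooth_with L f"
  shows "f (x + d) \<le> f x + grad f x \<bullet> d + L / 2 * (norm d)\<^sup>2"
proof -
  define \<phi> where "\<phi> t = f (x + t *\<^sub>R d) - t * (grad f x \<bullet> d) - t\<^sup>2 * (L / 2 * (norm d)\<^sup>2)" for t :: real
  have "\<phi> 1 \<le> \<phi> 0"
  proof (rule DERIV_nonpos_imp_nonincreasing[of 0 1 \<phi>])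
    fix t :: real assume t: "0 \<le> t" "t \<le> 1"
    have "(\<phi> has_real_derivative
        grad f (x + t *\<^sub>R d) \<bullet> d - grad f x \<bullet> d - 2 * t * (L / 2 * (norm d)\<^sup>2)) (at t)"
      unfolding \<phi>_def
      by (auto intro!: derivative_eq_intros GDERIV_along_line[OF diff])
    moreover have "grad f (x + t *\<^sub>R d) \<bullet> d - grad f x \<bullet> d \<le> 2 * t * (L / 2 * (norm d)\<^sup>2)"
    proof -
      have "(grad f (x + t *\<^sub>R d) - grad f x) \<bullet> d \<le> norm (grad f (x + t *\<^sub>R d) - grad f x) * norm d"
        by (rule norm_cauchy_schwarz)
      also have "\<dots> \<le> (L * norm (t *\<^sub>R d)) * norm d"
        using lipschitz_onD[OF smooth[unfolded smooth_with_def], of "x + t *\<^sub>R d" x]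
        by (intro mult_right_mono) (auto simp: dist_norm)
      finally show ?thesis using t by (simp add: inner_diff_left power2_eq_square mult_ac)
    qed
    ultimately show "\<exists>y. (\<phi> has_real_derivative y) (at t) \<and> y \<le> 0" by force
  qed simp
  then show ?thesis by (simp add: \<phi>_def)
qed

text \<open>The difference quotients in the direction of the gradient \<open>G\<close> tend to \<open>|G|\<^sup>2\<close> and are at most \<open>\<rho> |G|\<close>.\<close>

lemma norm_grad_le_lipschitz:
  assumes diff: "\<And>y. f differentiable (at y)" and lip: "lipschitz_on \<rho> UNIV f"
  shows "norm (grad f x) \<le> \<rho>"
proof (cases "grad f x = 0")
  case True
  then show ?thesis using lipschitz_on_nonneg[OF lip] by simp
next
  case False
  let ?G = "grad f x"
  have "((\<lambda>t::real. f (x + t *\<^sub>R ?G)) has_real_derivative (?G \<bullet> ?G)) (at 0)"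
    using GDERIV_along_line[OF diff, of x ?G 0] by simp
  then have lim: "((\<lambda>h. (f (x + h *\<^sub>R ?G) - f x) / h) \<longlongrightarrow> ?G \<bullet> ?G) (at 0)"
    unfolding DERIV_def by simp
  have "?G \<bullet> ?G \<le> \<rho> * norm ?G"
  proof (rule tendsto_upperbound[OF lim])
    have "(f (x + h *\<^sub>R ?G) - f x) / h \<le> \<rho> * norm ?G" if "h \<noteq> 0" for h
    proof -
      have "\<bar>f (x + h *\<^sub>R ?G) - f x\<bar> \<le> \<rho> * (\<bar>h\<bar> * norm ?G)"
        using lipschitz_onD[OF lip, of "x + h *\<^sub>R ?G" x] by (simp add: dist_norm)
      then have "\<bar>(f (x + h *\<^sub>R ?G) - f x) / h\<bar> \<le> \<rho> * norm ?G"
        using that by (simp add: abs_divide divide_le_eq mult_ac)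
      then show ?thesis by linarith
    qed
    then show "\<forall>\<^sub>F h in at 0. (f (x + h *\<^sub>R ?G) - f x) / h \<le> \<rho> * norm ?G"
      by (auto simp: eventually_at_filter)
  qed simp
  then have "norm ?G * norm ?G \<le> \<rho> * norm ?G" by (simp add: dot_square_norm power2_eq_square)
  then show ?thesis using False by simp
qed

lemma sgd_step_decrease:
  fixes x e g :: "'v::euclidean_space"
  assumes diff: "\<And>y. f differentiable (at y)" and smooth: "smooth_with L f"
    and \<eta>: "0 \<le> \<eta>" "L * \<eta> \<le> 1" and e: "e = grad f x - g"
  shows "\<eta> / 2 * (norm (grad f x))\<^sup>2
    \<le> f x - f (x - \<eta> *\<^sub>R g) + \<eta> * (1 - L * \<eta>) * (grad f x \<bullet> e) + L * \<eta>\<^sup>2 / 2 * (norm e)\<^sup>2"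
proof -
  let ?G = "grad f x"
  have g: "g = ?G - e" using e by simp
  have "f (x + (- \<eta>) *\<^sub>R g) \<le> f x + ?G \<bullet> ((- \<eta>) *\<^sub>R g) + L / 2 * (norm ((- \<eta>) *\<^sub>R g))\<^sup>2"
    by (rule smooth_quadratic_upper_bound[OF diff smooth])
  then have "f (x - \<eta> *\<^sub>R g) \<le> f x - \<eta> * (?G \<bullet> g) + L / 2 * (\<eta>\<^sup>2 * (g \<bullet> g))"
    by (simp add: power_mult_distrib power2_norm_eq_inner)
  also have "\<dots> = f x - \<eta> * (1 - L * \<eta> / 2) * (?G \<bullet> ?G) + \<eta> * (1 - L * \<eta>) * (?G \<bullet> e) + L * \<eta>\<^sup>2 / 2 * (e \<bullet> e)"
    unfolding g by (simp add: inner_diff_left inner_diff_right inner_commute power2_eq_square algebra_simps)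
  finally have *: "f (x - \<eta> *\<^sub>R g) \<le> \<dots>" .
  have "\<eta> * (1 / 2) * (?G \<bullet> ?G) \<le> \<eta> * (1 - L * \<eta> / 2) * (?G \<bullet> ?G)"
    using \<eta> by (intro mult_right_mono mult_left_mono) auto
  then show ?thesis using * by (simp add: power2_norm_eq_inner)
qed

text \<open>Each summand is compared with an increment of the logarithm: \<open>u / 2 \<le> ln (1 + u)\<close> on \<open>[0, 1]\<close>.\<close>

lemma harmonic_le_ln: "(\<Sum>t<T. 1 / (real t + 1)) \<le> 2 * ln (real T + 1)"
proof (induction T)
  case (Suc T)
  define u where "u = 1 / (real T + 1)"
  have u: "0 \<le> u" "u \<le> 1" by (auto simp: u_def)
  have "u / 2 \<le> ln (1 + u)"
  proof -
    have "exp (u / 2) \<le> 1 + u / 2 + (u / 2)\<^sup>2" using u by (intro exp_bound) auto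
    also have "\<dots> \<le> 1 + u" using u mult_left_mono[of u 1 u] by (simp add: power2_eq_square)
    finally show ?thesis using u by (subst ln_ge_iff) auto
  qed
  also have "1 + u = (real (Suc T) + 1) / (real T + 1)" by (simp add: u_def field_simps)
  also have "ln \<dots> = ln (real (Suc T) + 1) - ln (real T + 1)" by (subst ln_div) auto
  finally have "u \<le> 2 * (ln (real (Suc T) + 1) - ln (real T + 1))" by simp
  from add_mono[OF Suc this] show ?case by (simp add: u_def algebra_simps)
qed simp

text \<open>The one-step estimate multiplied by \<open>4 / c\<close> controls \<open>2 a\<^sub>t |G\<^sub>t|\<^sup>2\<close>. One half is moved to the right, to be
  paired with the inner product.\<close>

lemma sgd_sum_decrease:
  fixes f :: "'v::euclidean_space \<Rightarrow> real" and x e g :: "nat \<Rightarrow> 'v"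
  assumes diff: "\<And>y. f differentiable (at y)" and smooth: "smooth_with L f" and L: "L > 0"
    and c: "0 < c" "c \<le> 1 / L" and \<eta>: "\<And>t. \<eta> t = c / sqrt (real t + 1)"
    and x: "\<And>t. x (Suc t) = x t - \<eta> t *\<^sub>R g t" and e: "\<And>t. e t = grad f (x t) - g t"
    and min: "\<And>y. fstar \<le> f y"
  shows "(\<Sum>t<T. 1 / sqrt (real t + 1) * (norm (grad f (x t)))\<^sup>2)
    \<le> 4 / c * (f (x 0) - fstar)
      + (\<Sum>t<T. (4 * (1 - L * \<eta> t) * (grad f (x t) \<bullet> e t) - (norm (grad f (x t)))\<^sup>2) / sqrt (real t + 1))
      + 2 * L * c * (\<Sum>t<T. 1 / (real t + 1) * (norm (e t))\<^sup>2)"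
proof -
  define D where "D t = (4 * (1 - L * \<eta> t) * (grad f (x t) \<bullet> e t) - (norm (grad f (x t)))\<^sup>2) / sqrt (real t + 1)" for t
  have step: "1 / sqrt (real t + 1) * (norm (grad f (x t)))\<^sup>2
      \<le> 4 / c * (f (x t) - f (x (Suc t))) + D t + 2 * L * c * (1 / (real t + 1) * (norm (e t))\<^sup>2)" for t
  proof -
    define a where "a = 1 / sqrt (real t + 1)"
    have a: "0 < a" "a \<le> 1" "a\<^sup>2 = 1 / (real t + 1)" by (auto simp: a_def power_divide)
    have \<eta>a: "\<eta> t = c * a" by (simp add: \<eta> a_def)
    have "L * (c * a) \<le> 1 * 1" using c L a
      by (subst mult.assoc[symmetric], intro mult_mono) (auto simp: field_simps)
    then have "\<eta> t / 2 * (norm (grad f (x t)))\<^sup>2 \<le> f (x t) - f (x (Suc t))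
        + \<eta> t * (1 - L * \<eta> t) * (grad f (x t) \<bullet> e t) + L * (\<eta> t)\<^sup>2 / 2 * (norm (e t))\<^sup>2"
      unfolding x using c a by (intro sgd_step_decrease[OF diff smooth _ _ e]) (auto simp: \<eta>a)
    then have "4 / c * (\<eta> t / 2 * (norm (grad f (x t)))\<^sup>2) \<le> 4 / c * (f (x t) - f (x (Suc t))
        + \<eta> t * (1 - L * \<eta> t) * (grad f (x t) \<bullet> e t) + L * (\<eta> t)\<^sup>2 / 2 * (norm (e t))\<^sup>2)"
      using c by (intro mult_left_mono) auto
    also have "4 / c * (\<eta> t / 2 * (norm (grad f (x t)))\<^sup>2) = 2 * a * (norm (grad f (x t)))\<^sup>2"
      using c by (simp add: \<eta>a)
    also have "4 / c * (f (x t) - f (x (Suc t))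
        + \<eta> t * (1 - L * \<eta> t) * (grad f (x t) \<bullet> e t) + L * (\<eta> t)\<^sup>2 / 2 * (norm (e t))\<^sup>2)
      = 4 / c * (f (x t) - f (x (Suc t))) + 4 * a * (1 - L * \<eta> t) * (grad f (x t) \<bullet> e t)
        + 2 * L * c * (a\<^sup>2 * (norm (e t))\<^sup>2)"
      using c unfolding \<eta>a by (simp add: field_simps power2_eq_square)
    also have "4 * a * (1 - L * \<eta> t) * (grad f (x t) \<bullet> e t) = D t + a * (norm (grad f (x t)))\<^sup>2"
      by (simp add: D_def a_def field_simps)
    finally have "2 * (a * (norm (grad f (x t)))\<^sup>2) \<le> 4 / c * (f (x t) - f (x (Suc t))) + (D t + a * (norm (grad f (x t)))\<^sup>2)
        + 2 * L * c * (a\<^sup>2 * (norm (e t))\<^sup>2)" by (simp only: mult.assoc)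
    then show ?thesis unfolding a(3) a_def[symmetric] by linarith
  qed
  have "(\<Sum>t<T. 1 / sqrt (real t + 1) * (norm (grad f (x t)))\<^sup>2)
    \<le> (\<Sum>t<T. 4 / c * (f (x t) - f (x (Suc t))) + D t + 2 * L * c * (1 / (real t + 1) * (norm (e t))\<^sup>2))"
    by (intro sum_mono step)
  also have "\<dots> = 4 / c * (\<Sum>t<T. f (x t) - f (x (Suc t))) + (\<Sum>t<T. D t)
      + 2 * L * c * (\<Sum>t<T. 1 / (real t + 1) * (norm (e t))\<^sup>2)"
    by (simp only: sum.distrib sum_distrib_left)
  also have "(\<Sum>t<T. f (x t) - f (x (Suc t))) = f (x 0) - f (x T)"
    by (rule sum_lessThan_telescope')
  also have "4 / c * (f (x 0) - f (x T)) \<le> 4 / c * (f (x 0) - fstar)"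
    using c min[of "x T"] by (intro mult_left_mono) auto
  finally show ?thesis by (simp add: D_def)
qed

section \<open>Concentration of sub-Weibull variables\<close>

lemma (in prob_space) sub_Weibull_tail:
  fixes Y :: "'a \<Rightarrow> real"
  assumes [measurable]: "Y \<in> borel_measurable M" and Y: "\<And>\<omega>. 0 \<le> Y \<omega>"
    and E: "(\<integral>\<^sup>+\<omega>. ennreal (exp (Y \<omega> powr (1 / \<theta>))) \<partial>M) \<le> 2" and \<theta>: "\<theta> > 0" and b: "b \<ge> 0"
  shows "prob {\<omega> \<in> space M. b powr \<theta> < Y \<omega>} \<le> 2 * exp (- b)"
proof -
  have "emeasure M {\<omega> \<in> space M. b powr \<theta> < Y \<omega>}
      \<le> emeasure M {\<omega> \<in> space M. 1 \<le> ennreal (exp (- b)) * ennreal (exp (Y \<omega> powr (1 / \<theta>)))}"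
  proof (intro emeasure_mono subsetI CollectI conjI; clarsimp)
    fix \<omega> assume "b powr \<theta> < Y \<omega>"
    then have "(b powr \<theta>) powr (1 / \<theta>) \<le> Y \<omega> powr (1 / \<theta>)" using \<theta> by (intro powr_mono2) auto
    then have "1 \<le> exp (- b) * exp (Y \<omega> powr (1 / \<theta>))" using b \<theta> by (simp add: powr_powr flip: exp_add)
    then show "1 \<le> ennreal (exp (- b)) * ennreal (exp (Y \<omega> powr (1 / \<theta>)))"
      by (simp flip: ennreal_mult)
  qed
  also have "\<dots> \<le> ennreal (exp (- b)) * (\<integral>\<^sup>+\<omega>. ennreal (exp (Y \<omega> powr (1 / \<theta>))) * indicator (space M) \<omega> \<partial>M)"
    by (rule nn_integral_Markov_inequality) auto
  also have "(\<integral>\<^sup>+\<omega>. ennreal (exp (Y \<omega> powr (1 / \<theta>))) * indicator (space M) \<omega> \<partial>M)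
      = (\<integral>\<^sup>+\<omega>. ennreal (exp (Y \<omega> powr (1 / \<theta>))) \<partial>M)"
    by (intro nn_integral_cong) simp
  also have "ennreal (exp (- b)) * \<dots> \<le> ennreal (exp (- b)) * 2" using E by (rule mult_left_mono) simp
  also have "\<dots> = ennreal (2 * exp (- b))" by (simp add: ennreal_mult'' mult.commute)
  finally show ?thesis by (simp add: emeasure_eq_measure)
qed

text \<open>The \<open>p\<close>-th moment method with \<open>p = 2 e ln (2 / \<delta>)\<close>. Bernoulli's inequality at \<open>1\<close> takes the place of
  Jensen's: if a convex combination of numbers \<open>z\<^sub>i \<ge> 0\<close> is at least \<open>1\<close>, so is that of their powers
  \<open>z\<^sub>i\<^bsup>p\<^esup>\<close>. With this \<open>p\<close> the ratio \<open>(2 \<theta> p / e) / (4 e \<theta> ln (2 / \<delta>))\<close> is exactly \<open>1 / e\<close>, and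
  \<open>\<theta> \<ge> 1/2\<close> makes the resulting \<open>exp (- 2 \<theta> p)\<close> at most \<open>\<delta> / 2\<close>.\<close>

lemma (in prob_space) weighted_sum_sub_Weibull_tail:
  fixes Y :: "'i \<Rightarrow> 'a \<Rightarrow> real"
  assumes [measurable]: "\<And>i. i \<in> I \<Longrightarrow> Y i \<in> borel_measurable M" and Y: "\<And>i \<omega>. 0 \<le> Y i \<omega>"
    and E: "\<And>i. i \<in> I \<Longrightarrow> (\<integral>\<^sup>+\<omega>. ennreal (exp (Y i \<omega> powr (1 / \<theta>))) \<partial>M) \<le> 2"
    and \<theta>: "\<theta> \<ge> 1/2" and \<delta>: "\<delta> \<in> {0<..<1}"
    and I: "finite I" and w: "\<And>i. i \<in> I \<Longrightarrow> 0 \<le> w i" and W: "0 < sum w I"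
  shows "prob {\<omega> \<in> space M. sum w I * (4 * exp 1 * \<theta> * ln (2 / \<delta>)) powr (2 * \<theta>) < (\<Sum>i\<in>I. w i * (Y i \<omega>)\<^sup>2)} \<le> \<delta>"
proof -
  define l where "l = ln (2 / \<delta>)"
  define p where "p = 2 * exp 1 * l"
  define s where "s = (4 * exp 1 * \<theta> * l) powr (2 * \<theta>)"
  define W where "W = sum w I"
  have "1 / 2 \<le> ln (2::real)"
  proof -
    have "exp (1/2) \<le> 1 + 1/2 + (1/2 :: real)\<^sup>2" by (intro exp_bound) auto
    then show ?thesis by (subst ln_ge_iff) (auto simp: power2_eq_square)
  qed
  also have "ln 2 \<le> l" unfolding l_def using \<delta> by (intro ln_mono) (auto simp: field_simps)
  finally have l: "1 / 2 \<le> l" .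
  have p: "1 \<le> p" "l \<le> p" unfolding p_def
    using l mult_mono[of 2 "2 * exp 1" "1/2" l] mult_right_mono[of 1 "2 * exp 1" l] two_le_exp_1 by auto
  have s: "s > 0" using l \<theta> by (auto simp: s_def)
  have \<delta>e: "exp (- l) = \<delta> / 2" using \<delta> by (simp add: l_def exp_minus)

  have moment: "((Y i \<omega>)\<^sup>2 / s) powr p \<le> exp (- l) * exp (Y i \<omega> powr (1 / \<theta>))" for i \<omega>
  proof -
    define V where "V = Y i \<omega> powr (1 / \<theta>)"
    define a where "a = 2 * \<theta> * p"
    have a: "a > 0" using \<theta> p by (simp add: a_def)
    have V: "V \<ge> 0" "Y i \<omega> = V powr \<theta>" using Y \<theta> by (auto simp: V_def powr_powr)
    have Y2: "(Y i \<omega>)\<^sup>2 = V powr (2 * \<theta>)" unfolding V(2) power2_eq_square by (simp flip: powr_add)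
    have "((Y i \<omega>)\<^sup>2 / s) powr p = V powr a / (4 * exp 1 * \<theta> * l) powr a"
      unfolding Y2 s_def a_def using V \<theta> l by (simp add: powr_divide powr_powr)
    also have "\<dots> \<le> (a / exp 1) powr a * exp V / (4 * exp 1 * \<theta> * l) powr a"
      using powr_exp_minus_le[OF a V(1)] by (intro divide_right_mono) auto
    also have "\<dots> = ((a / exp 1) / (4 * exp 1 * \<theta> * l)) powr a * exp V"
      using a \<theta> l by (subst powr_divide) auto
    also have "(a / exp 1) / (4 * exp 1 * \<theta> * l) = exp (- 1)"
      using \<theta> l by (simp add: a_def p_def exp_minus field_simps)
    also have "exp (- 1) powr a = exp (- a)" by (simp add: powr_def)
    also have "exp (- a) * exp V \<le> exp (- l) * exp V"
    proof -
      have "1 * l \<le> (2 * \<theta>) * p" using \<theta> p l by (intro mult_mono) auto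
      then show ?thesis by (intro mult_right_mono) (auto simp: a_def)
    qed
    finally show ?thesis by (simp add: V_def)
  qed
  \<comment> \<open>On the event in question the average of the weights is at least \<open>2 / \<delta>\<close>, by Bernoulli.\<close>
  have pt: "1 \<le> (\<Sum>i\<in>I. w i / W * (exp (- l) * exp (Y i \<omega> powr (1 / \<theta>))))"
    if "W * s < (\<Sum>i\<in>I. w i * (Y i \<omega>)\<^sup>2)" for \<omega>
  proof -
    have W1: "(\<Sum>i\<in>I. w i / W) = 1" using W by (simp add: W_def flip: sum_divide_distrib)
    have "1 \<le> (\<Sum>i\<in>I. w i * (Y i \<omega>)\<^sup>2) / (W * s)" using that W s by (simp add: W_def)
    also have "\<dots> = (\<Sum>i\<in>I. w i / W * ((Y i \<omega>)\<^sup>2 / s))" by (simp add: sum_divide_distrib)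
    finally have 1: "1 \<le> (\<Sum>i\<in>I. w i / W * ((Y i \<omega>)\<^sup>2 / s))" .
    have "1 \<le> 1 + p * ((\<Sum>i\<in>I. w i / W * ((Y i \<omega>)\<^sup>2 / s)) - 1)" using 1 p by simp
    also have "\<dots> = (\<Sum>i\<in>I. w i / W) + p * ((\<Sum>i\<in>I. w i / W * ((Y i \<omega>)\<^sup>2 / s)) - (\<Sum>i\<in>I. w i / W))"
      by (simp only: W1)
    also have "\<dots> = (\<Sum>i\<in>I. w i / W * (1 + p * ((Y i \<omega>)\<^sup>2 / s - 1)))"
      by (simp only: sum_distrib_left sum.distrib[symmetric] sum_subtractf[symmetric])
        (intro sum.cong refl, simp add: algebra_simps)
    also have "\<dots> \<le> (\<Sum>i\<in>I. w i / W * ((Y i \<omega>)\<^sup>2 / s) powr p)"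
      using w W s p by (intro sum_mono mult_left_mono Bernoulli_inequality_powr) (auto simp: W_def)
    also have "\<dots> \<le> (\<Sum>i\<in>I. w i / W * (exp (- l) * exp (Y i \<omega> powr (1 / \<theta>))))"
      using w W by (intro sum_mono mult_left_mono moment) (auto simp: W_def)
    finally show ?thesis .
  qed
  let ?A = "{\<omega> \<in> space M. W * s < (\<Sum>i\<in>I. w i * (Y i \<omega>)\<^sup>2)}"
  have "emeasure M ?A = (\<integral>\<^sup>+\<omega>. indicator ?A \<omega> \<partial>M)" by (simp add: nn_integral_indicator)
  also have "\<dots> \<le> (\<integral>\<^sup>+\<omega>. (\<Sum>i\<in>I. ennreal (w i / W * exp (- l)) * ennreal (exp (Y i \<omega> powr (1 / \<theta>)))) \<partial>M)"
  proof (intro nn_integral_mono)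
    fix \<omega>
    show "indicator ?A \<omega> \<le> (\<Sum>i\<in>I. ennreal (w i / W * exp (- l)) * ennreal (exp (Y i \<omega> powr (1 / \<theta>))))"
    proof (cases "\<omega> \<in> ?A")
      case True
      then have "ennreal 1 \<le> ennreal (\<Sum>i\<in>I. w i / W * (exp (- l) * exp (Y i \<omega> powr (1 / \<theta>))))"
        using pt by (intro ennreal_leI) auto
      also have "\<dots> = (\<Sum>i\<in>I. ennreal (w i / W * (exp (- l) * exp (Y i \<omega> powr (1 / \<theta>)))))"
        using w W by (intro sum_ennreal[symmetric]) (auto simp: W_def)
      also have "\<dots> = (\<Sum>i\<in>I. ennreal (w i / W * exp (- l)) * ennreal (exp (Y i \<omega> powr (1 / \<theta>))))"
        using w W by (intro sum.cong refl) (auto simp: W_def mult.assoc simp flip: ennreal_mult)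
      finally show ?thesis using True by simp
    qed simp
  qed
  also have "\<dots> = (\<Sum>i\<in>I. \<integral>\<^sup>+\<omega>. ennreal (w i / W * exp (- l)) * ennreal (exp (Y i \<omega> powr (1 / \<theta>))) \<partial>M)"
    by (rule nn_integral_sum) measurable
  also have "\<dots> = (\<Sum>i\<in>I. ennreal (w i / W * exp (- l)) * (\<integral>\<^sup>+\<omega>. ennreal (exp (Y i \<omega> powr (1 / \<theta>))) \<partial>M))"
    by (intro sum.cong refl nn_integral_cmult) measurable
  also have "\<dots> \<le> (\<Sum>i\<in>I. ennreal (w i / W * exp (- l)) * ennreal 2)"
    using E by (intro sum_mono mult_left_mono) auto
  also have "\<dots> = (\<Sum>i\<in>I. ennreal (w i / W * exp (- l) * 2))"
    using w W by (intro sum.cong refl ennreal_mult[symmetric]) (auto simp: W_def)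
  also have "\<dots> = ennreal (\<Sum>i\<in>I. w i / W * exp (- l) * 2)"
    using w W by (intro sum_ennreal) (auto simp: W_def)
  also have "(\<Sum>i\<in>I. w i / W * exp (- l) * 2) = \<delta>"
    using W by (simp add: \<delta>e W_def flip: sum_divide_distrib sum_distrib_right)
  finally have "emeasure M ?A \<le> ennreal \<delta>" .
  then show ?thesis using \<delta> unfolding W_def s_def l_def by (simp add: emeasure_eq_measure)
qed

section \<open>Exponential supermartingales with centred noise\<close>

text \<open>The conditional expectation of the linear term vanishes and that of \<open>E\<close> is at most \<open>2\<close>. As \<open>S\<close>, \<open>U\<close> and
  \<open>h\<close> are unbounded, the linear term need not be integrable; therefore everything is first restricted to the
  \<open>F\<close>-measurable events on which the three are at most \<open>n\<close>, and \<open>n\<close> tends to infinity by monotone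
  convergence.\<close>

lemma (in prob_space) cond_exp_step:
  fixes e U :: "'a \<Rightarrow> real ^ 'd" and S N h E :: "'a \<Rightarrow> real"
  assumes F: "subalgebra M F"
    and [measurable]: "S \<in> borel_measurable F" "U \<in> borel_measurable F" "h \<in> borel_measurable F"
      "N \<in> borel_measurable M" "E \<in> borel_measurable M"
    and e: "integrable M e" and centered: "cond_centered M F e"
    and E: "AE \<omega> in M. nn_cond_exp M F (\<lambda>\<omega>. ennreal (E \<omega>)) \<omega> \<le> 2" and E0: "\<And>\<omega>. 0 \<le> E \<omega>"
    and S: "\<And>\<omega>. 0 \<le> S \<omega>" and N: "\<And>\<omega>. 0 \<le> N \<omega>" and h: "\<And>\<omega>. 0 \<le> h \<omega>"
    and dom: "\<And>\<omega>. N \<omega> \<le> 1 + U \<omega> \<bullet> e \<omega> + h \<omega> * E \<omega>"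
  shows "(\<integral>\<^sup>+\<omega>. ennreal (S \<omega> * N \<omega>) \<partial>M) \<le> (\<integral>\<^sup>+\<omega>. ennreal (S \<omega> * (1 + 2 * h \<omega>)) \<partial>M)"
proof -
  interpret finite_measure_subalgebra M F by standard (rule F)
  note FM = measurable_from_subalg[OF F]
  have [measurable]: "S \<in> borel_measurable M" "U \<in> borel_measurable M" "h \<in> borel_measurable M"
    by (auto intro: FM)
  note [measurable] = borel_measurable_integrable[OF e]
  have nth: "(\<lambda>v :: real ^ 'd. v $ i) \<in> borel_measurable borel" for i
    by (intro borel_measurable_continuous_onI continuous_intros)
  have [measurable]: "(\<lambda>\<omega>. e \<omega> $ i) \<in> borel_measurable M" "(\<lambda>\<omega>. U \<omega> $ i) \<in> borel_measurable M"
    "(\<lambda>\<omega>. U \<omega> $ i) \<in> borel_measurable F" for i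
    by (auto intro: measurable_compose[OF _ nth])
  have E_int: "(\<integral>\<^sup>+\<omega>. ennreal (\<phi> \<omega>) * ennreal (E \<omega>) \<partial>M) \<le> 2 * (\<integral>\<^sup>+\<omega>. ennreal (\<phi> \<omega>) \<partial>M)"
    if [measurable]: "\<phi> \<in> borel_measurable F" for \<phi>
  proof -
    have [measurable]: "\<phi> \<in> borel_measurable M" using that by (rule FM)
    have "(\<integral>\<^sup>+\<omega>. ennreal (\<phi> \<omega>) * ennreal (E \<omega>) \<partial>M)
        = (\<integral>\<^sup>+\<omega>. ennreal (\<phi> \<omega>) * nn_cond_exp M F (\<lambda>\<omega>. ennreal (E \<omega>)) \<omega> \<partial>M)"
      by (rule nn_cond_exp_intg[symmetric]) measurable
    also have "\<dots> \<le> (\<integral>\<^sup>+\<omega>. ennreal (\<phi> \<omega>) * 2 \<partial>M)"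
    proof (rule nn_integral_mono_AE)
      show "AE \<omega> in M. ennreal (\<phi> \<omega>) * nn_cond_exp M F (\<lambda>\<omega>. ennreal (E \<omega>)) \<omega> \<le> ennreal (\<phi> \<omega>) * 2"
        using E by eventually_elim (auto intro: mult_left_mono)
    qed
    also have "\<dots> = (\<integral>\<^sup>+\<omega>. ennreal (\<phi> \<omega>) \<partial>M) * 2" by (rule nn_integral_multc) measurable
    finally show ?thesis by (simp add: mult.commute)
  qed
  have E_integrable: "integrable M E"
    using E_int[of "\<lambda>_. 1"] E0 
    by (intro integrableI_bounded) (auto simp: emeasure_space_1 less_top[symmetric] top_unique)
  define A where "A n = {\<omega> \<in> space M. S \<omega> \<le> real n \<and> norm (U \<omega>) \<le> real n \<and> h \<omega> \<le> real n}" for n :: nat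
  have A_F [measurable]: "A n \<in> sets F" for n
  proof -
    have "A n = {\<omega> \<in> space F. S \<omega> \<le> real n \<and> norm (U \<omega>) \<le> real n \<and> h \<omega> \<le> real n}"
      using F by (simp add: A_def subalgebra_def)
    then show ?thesis by simp
  qed
  have A_M [measurable]: "A n \<in> sets M" for n using A_F F by (auto simp: subalgebra_def)
  have bounded_step: "(\<integral>\<^sup>+\<omega>. ennreal (S \<omega> * N \<omega>) * indicator (A n) \<omega> \<partial>M)
      \<le> (\<integral>\<^sup>+\<omega>. ennreal (S \<omega> * (1 + 2 * h \<omega>)) \<partial>M)" for n
  proof -
    define \<phi> where "\<phi> \<omega> = S \<omega> * indicator (A n) \<omega>" for \<omega>
    have [measurable]: "\<phi> \<in> borel_measurable F" unfolding \<phi>_def by measurable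
    then have [measurable]: "\<phi> \<in> borel_measurable M" by (rule FM)
    have \<phi>: "0 \<le> \<phi> \<omega>" "\<phi> \<omega> \<le> real n" "\<phi> \<omega> * norm (U \<omega>) \<le> real n * real n" "\<phi> \<omega> * h \<omega> \<le> real n * real n" for \<omega>
      using S h by (auto simp: \<phi>_def A_def indicator_def intro!: mult_mono)
    have int\<phi>: "integrable M \<phi>"
      using \<phi> by (intro integrable_const_bound[where B = "real n"]) auto
    have int_comp: "integrable M (\<lambda>\<omega>. \<phi> \<omega> * U \<omega> $ i * e \<omega> $ i)" for i
    proof (rule Bochner_Integration.integrable_bound)
      show "integrable M (\<lambda>\<omega>. real n * real n * norm (e \<omega>))" using e by simp
      show "AE \<omega> in M. norm (\<phi> \<omega> * U \<omega> $ i * e \<omega> $ i) \<le> norm (real n * real n * norm (e \<omega>))"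
      proof (intro AE_I2)
        fix \<omega>
        have "norm (\<phi> \<omega> * U \<omega> $ i * e \<omega> $ i) = \<phi> \<omega> * \<bar>U \<omega> $ i\<bar> * \<bar>e \<omega> $ i\<bar>"
          using \<phi>(1) by (simp add: abs_mult)
        also have "\<dots> \<le> \<phi> \<omega> * norm (U \<omega>) * norm (e \<omega>)"
          using \<phi>(1) by (intro mult_mono component_le_norm_cart mult_nonneg_nonneg) auto
        also have "\<dots> \<le> real n * real n * norm (e \<omega>)" using \<phi>(3) by (intro mult_right_mono) auto
        finally show "norm (\<phi> \<omega> * U \<omega> $ i * e \<omega> $ i) \<le> norm (real n * real n * norm (e \<omega>))" by simp
      qed
    qed measurable
    have comp0: "(\<integral>\<omega>. \<phi> \<omega> * U \<omega> $ i * e \<omega> $ i \<partial>M) = 0" for i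
    proof -
      have "(\<integral>\<omega>. \<phi> \<omega> * U \<omega> $ i * e \<omega> $ i \<partial>M) = (\<integral>\<omega>. \<phi> \<omega> * U \<omega> $ i * real_cond_exp M F (\<lambda>\<omega>. e \<omega> $ i) \<omega> \<partial>M)"
        by (rule real_cond_exp_intg(2)[symmetric, OF int_comp]) measurable
      also have "\<dots> = (\<integral>\<omega>. 0 \<partial>M)"
      proof (rule integral_cong_AE)
        show "AE \<omega> in M. \<phi> \<omega> * U \<omega> $ i * real_cond_exp M F (\<lambda>\<omega>. e \<omega> $ i) \<omega> = 0"
          using centered unfolding cond_centered_def
          by eventually_elim (simp add: vec_cond_exp_def vec_eq_iff)
      qed (use borel_measurable_cond_exp2 in measurable)
      finally show ?thesis by simp
    qed
    have int_inner: "integrable M (\<lambda>\<omega>. \<phi> \<omega> * (U \<omega> \<bullet> e \<omega>))"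
      and inner0: "(\<integral>\<omega>. \<phi> \<omega> * (U \<omega> \<bullet> e \<omega>) \<partial>M) = 0"
    proof -
      have eq: "\<phi> \<omega> * (U \<omega> \<bullet> e \<omega>) = (\<Sum>i\<in>UNIV. \<phi> \<omega> * U \<omega> $ i * e \<omega> $ i)" for \<omega>
        by (simp add: inner_vec_def sum_distrib_left mult.assoc)
      show "integrable M (\<lambda>\<omega>. \<phi> \<omega> * (U \<omega> \<bullet> e \<omega>))" unfolding eq using int_comp by simp
      show "(\<integral>\<omega>. \<phi> \<omega> * (U \<omega> \<bullet> e \<omega>) \<partial>M) = 0"
        unfolding eq using int_comp comp0 by (subst Bochner_Integration.integral_sum) auto
    qed
    have int_hE: "integrable M (\<lambda>\<omega>. \<phi> \<omega> * h \<omega> * E \<omega>)"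
    proof (rule Bochner_Integration.integrable_bound)
      show "integrable M (\<lambda>\<omega>. real n * real n * E \<omega>)" using E_integrable by simp
      show "AE \<omega> in M. norm (\<phi> \<omega> * h \<omega> * E \<omega>) \<le> norm (real n * real n * E \<omega>)"
        using \<phi>(1,4) h E0 by (intro AE_I2) (auto simp: abs_mult intro!: mult_right_mono)
    qed measurable
    have int_h: "integrable M (\<lambda>\<omega>. \<phi> \<omega> * h \<omega>)"
      using \<phi> h by (intro integrable_const_bound[where B = "real n * real n"]) (auto intro!: AE_I2)
    have le_hE: "(\<integral>\<omega>. \<phi> \<omega> * h \<omega> * E \<omega> \<partial>M) \<le> 2 * (\<integral>\<omega>. \<phi> \<omega> * h \<omega> \<partial>M)"
    proof -
      have nn: "0 \<le> (\<integral>\<omega>. \<phi> \<omega> * h \<omega> \<partial>M)" using \<phi>(1) h by (intro integral_nonneg_AE) auto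
      have "ennreal (\<integral>\<omega>. \<phi> \<omega> * h \<omega> * E \<omega> \<partial>M) = (\<integral>\<^sup>+\<omega>. ennreal (\<phi> \<omega> * h \<omega> * E \<omega>) \<partial>M)"
        using \<phi>(1) h E0 by (intro nn_integral_eq_integral[OF int_hE, symmetric]) auto
      also have "\<dots> = (\<integral>\<^sup>+\<omega>. ennreal (\<phi> \<omega> * h \<omega>) * ennreal (E \<omega>) \<partial>M)"
        using \<phi>(1) h E0 by (intro nn_integral_cong) (auto simp: ennreal_mult)
      also have "\<dots> \<le> 2 * (\<integral>\<^sup>+\<omega>. ennreal (\<phi> \<omega> * h \<omega>) \<partial>M)" by (rule E_int) measurable
      also have "(\<integral>\<^sup>+\<omega>. ennreal (\<phi> \<omega> * h \<omega>) \<partial>M) = ennreal (\<integral>\<omega>. \<phi> \<omega> * h \<omega> \<partial>M)"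
        using \<phi>(1) h by (intro nn_integral_eq_integral[OF int_h]) auto
      also have "2 * \<dots> = ennreal (2 * (\<integral>\<omega>. \<phi> \<omega> * h \<omega> \<partial>M))" using nn by (simp add: ennreal_mult)
      finally show ?thesis using nn by (subst (asm) ennreal_le_iff) auto
    qed
    have expand: "\<phi> \<omega> * (1 + 2 * h \<omega>) = \<phi> \<omega> + 2 * (\<phi> \<omega> * h \<omega>)" for \<omega>
      by (simp add: algebra_simps)
    have "(\<integral>\<^sup>+\<omega>. ennreal (S \<omega> * N \<omega>) * indicator (A n) \<omega> \<partial>M) = (\<integral>\<^sup>+\<omega>. ennreal (\<phi> \<omega> * N \<omega>) \<partial>M)"
      by (intro nn_integral_cong) (auto simp: \<phi>_def indicator_def)
    also have "\<dots> \<le> (\<integral>\<^sup>+\<omega>. ennreal (\<phi> \<omega> * (1 + U \<omega> \<bullet> e \<omega> + h \<omega> * E \<omega>)) \<partial>M)"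
      using dom \<phi>(1) by (intro nn_integral_mono ennreal_leI mult_left_mono) auto
    also have "\<dots> = (\<integral>\<^sup>+\<omega>. ennreal (\<phi> \<omega> + \<phi> \<omega> * (U \<omega> \<bullet> e \<omega>) + \<phi> \<omega> * h \<omega> * E \<omega>) \<partial>M)"
      by (simp add: algebra_simps)
    also have "\<dots> = ennreal (\<integral>\<omega>. \<phi> \<omega> + \<phi> \<omega> * (U \<omega> \<bullet> e \<omega>) + \<phi> \<omega> * h \<omega> * E \<omega> \<partial>M)"
    proof (rule nn_integral_eq_integral)
      show "AE \<omega> in M. 0 \<le> \<phi> \<omega> + \<phi> \<omega> * (U \<omega> \<bullet> e \<omega>) + \<phi> \<omega> * h \<omega> * E \<omega>"
      proof (intro AE_I2)
        fix \<omega>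
        have "0 \<le> \<phi> \<omega> * (1 + U \<omega> \<bullet> e \<omega> + h \<omega> * E \<omega>)"
          using \<phi>(1) order_trans[OF N dom] by (intro mult_nonneg_nonneg) auto
        then show "0 \<le> \<phi> \<omega> + \<phi> \<omega> * (U \<omega> \<bullet> e \<omega>) + \<phi> \<omega> * h \<omega> * E \<omega>" by (simp add: algebra_simps)
      qed
    qed (use int\<phi> int_inner int_hE in simp)
    also have "(\<integral>\<omega>. \<phi> \<omega> + \<phi> \<omega> * (U \<omega> \<bullet> e \<omega>) + \<phi> \<omega> * h \<omega> * E \<omega> \<partial>M)
        = (\<integral>\<omega>. \<phi> \<omega> \<partial>M) + (\<integral>\<omega>. \<phi> \<omega> * h \<omega> * E \<omega> \<partial>M)"
      using int\<phi> int_inner int_hE inner0 by simp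
    also have "\<dots> \<le> (\<integral>\<omega>. \<phi> \<omega> \<partial>M) + 2 * (\<integral>\<omega>. \<phi> \<omega> * h \<omega> \<partial>M)" using le_hE by simp
    also have "\<dots> = (\<integral>\<omega>. \<phi> \<omega> * (1 + 2 * h \<omega>) \<partial>M)"
      unfolding expand using int\<phi> int_h by simp
    also have "ennreal \<dots> = (\<integral>\<^sup>+\<omega>. ennreal (\<phi> \<omega> * (1 + 2 * h \<omega>)) \<partial>M)"
    proof (rule nn_integral_eq_integral[symmetric])
      show "integrable M (\<lambda>\<omega>. \<phi> \<omega> * (1 + 2 * h \<omega>))"
        unfolding expand using int\<phi> int_h by simp
    qed (use \<phi>(1) h in auto)
    also have "\<dots> \<le> (\<integral>\<^sup>+\<omega>. ennreal (S \<omega> * (1 + 2 * h \<omega>)) \<partial>M)"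
      using S h by (intro nn_integral_mono ennreal_leI mult_right_mono) (auto simp: \<phi>_def indicator_def)
    finally show ?thesis by (simp add: ennreal_leI)
  qed
  have "(\<integral>\<^sup>+\<omega>. ennreal (S \<omega> * N \<omega>) \<partial>M) = (\<integral>\<^sup>+\<omega>. (SUP n. ennreal (S \<omega> * N \<omega>) * indicator (A n) \<omega>) \<partial>M)"
  proof (intro nn_integral_cong antisym)
    fix \<omega> assume \<omega>: "\<omega> \<in> space M"
    obtain n where "max (S \<omega>) (max (norm (U \<omega>)) (h \<omega>)) \<le> real n" using real_arch_simple by blast
    then have "\<omega> \<in> A n" using \<omega> by (simp add: A_def)
    then show "ennreal (S \<omega> * N \<omega>) \<le> (SUP n. ennreal (S \<omega> * N \<omega>) * indicator (A n) \<omega>)"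
      by (intro SUP_upper2[of n]) auto
    show "(SUP n. ennreal (S \<omega> * N \<omega>) * indicator (A n) \<omega>) \<le> ennreal (S \<omega> * N \<omega>)"
      by (intro SUP_least) (auto simp: indicator_def)
  qed
  also have "\<dots> = (SUP n. \<integral>\<^sup>+\<omega>. ennreal (S \<omega> * N \<omega>) * indicator (A n) \<omega> \<partial>M)"
  proof (rule nn_integral_monotone_convergence_SUP)
    show "incseq (\<lambda>n \<omega>. ennreal (S \<omega> * N \<omega>) * indicator (A n) \<omega>)"
      by (intro incseq_SucI le_funI mult_left_mono) (auto simp: A_def indicator_def)
  qed measurable
  also have "\<dots> \<le> (\<integral>\<^sup>+\<omega>. ennreal (S \<omega> * (1 + 2 * h \<omega>)) \<partial>M)"
    by (intro SUP_least bounded_step)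
  finally show ?thesis .
qed

text \<open>\<open>N t\<close> is the exponential of the \<open>t\<close>-th difference and \<open>r t\<close> the predictable factor that compensates
  its conditional mean.\<close>

lemma (in prob_space) exponential_supermartingale:
  fixes e U :: "nat \<Rightarrow> 'a \<Rightarrow> real ^ 'd" and r N h E :: "nat \<Rightarrow> 'a \<Rightarrow> real"
  assumes F: "\<And>t. subalgebra M (F t)" "\<And>t. subalgebra (F (Suc t)) (F t)"
    and meas [measurable]: "\<And>t. r t \<in> borel_measurable (F t)" "\<And>t. U t \<in> borel_measurable (F t)"
      "\<And>t. h t \<in> borel_measurable (F t)" "\<And>t. N t \<in> borel_measurable (F (Suc t))" "\<And>t. E t \<in> borel_measurable M"
    and e: "\<And>t. integrable M (e t)" and centered: "\<And>t. cond_centered M (F t) (e t)"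
    and E: "\<And>t. AE \<omega> in M. nn_cond_exp M (F t) (\<lambda>\<omega>. ennreal (E t \<omega>)) \<omega> \<le> 2" and E0: "\<And>t \<omega>. 0 \<le> E t \<omega>"
    and r: "\<And>t \<omega>. 0 \<le> r t \<omega>" and N: "\<And>t \<omega>. 0 \<le> N t \<omega>" and h: "\<And>t \<omega>. 0 \<le> h t \<omega>"
    and dom: "\<And>t \<omega>. N t \<omega> \<le> 1 + U t \<omega> \<bullet> e t \<omega> + h t \<omega> * E t \<omega>"
    and contract: "\<And>t \<omega>. r t \<omega> * (1 + 2 * h t \<omega>) \<le> 1"
  shows "(\<integral>\<^sup>+\<omega>. ennreal (\<Prod>t<T. r t \<omega> * N t \<omega>) \<partial>M) \<le> 1"
proof (induction T)
  case 0
  then show ?case by (simp add: emeasure_space_1)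
next
  case (Suc T)
  define S where "S T \<omega> = (\<Prod>t<T. r t \<omega> * N t \<omega>)" for T \<omega>
  have S_F: "S T \<in> borel_measurable (F T)" for T
  proof (induction T)
    case (Suc T)
    have [measurable]: "S T \<in> borel_measurable (F (Suc T))" "r T \<in> borel_measurable (F (Suc T))"
      using Suc by (auto intro: measurable_from_subalg[OF F(2)])
    have "S (Suc T) = (\<lambda>\<omega>. S T \<omega> * (r T \<omega> * N T \<omega>))" by (simp add: S_def fun_eq_iff)
    then show ?case by simp
  qed (simp add: S_def)
  note [measurable] = S_F
  have S0: "0 \<le> S T \<omega>" for \<omega> unfolding S_def using r N by (intro prod_nonneg) auto
  have "(\<integral>\<^sup>+\<omega>. ennreal (\<Prod>t<Suc T. r t \<omega> * N t \<omega>) \<partial>M) = (\<integral>\<^sup>+\<omega>. ennreal (S T \<omega> * r T \<omega> * N T \<omega>) \<partial>M)"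
    by (simp add: S_def mult.assoc)
  also have "\<dots> \<le> (\<integral>\<^sup>+\<omega>. ennreal (S T \<omega> * r T \<omega> * (1 + 2 * h T \<omega>)) \<partial>M)"
  proof (rule cond_exp_step[OF F(1), where e = "e T" and U = "U T" and E = "E T"])
    show "N T \<in> borel_measurable M" by (rule measurable_from_subalg[OF F(1)]) measurable
    show "(\<lambda>\<omega>. S T \<omega> * r T \<omega>) \<in> borel_measurable (F T)" by measurable
  qed (use S0 r N h E0 in \<open>auto intro!: meas e centered E dom\<close>)
  also have "\<dots> \<le> (\<integral>\<^sup>+\<omega>. ennreal (S T \<omega>) \<partial>M)"
  proof (intro nn_integral_mono ennreal_leI)
    fix \<omega>
    show "S T \<omega> * r T \<omega> * (1 + 2 * h T \<omega>) \<le> S T \<omega>"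
      using mult_left_mono[OF contract[of T \<omega>] S0[of \<omega>]] by (simp add: mult.assoc)
  qed
  also have "\<dots> \<le> 1" using Suc unfolding S_def .
  finally show ?case .
qed

section \<open>Stochastic gradient descent with sub-Weibull noise\<close>

locale sgd_sub_Weibull = prob_space M for M :: "'w measure" +
  fixes f :: "real ^ 'd \<Rightarrow> real" and x0 :: "real ^ 'd"
    and x g e :: "nat \<Rightarrow> 'w \<Rightarrow> real ^ 'd" and \<eta> :: "nat \<Rightarrow> real"
    and fstar L \<rho> K \<theta> c :: real
  assumes diff: "\<And>y. f differentiable (at y)" and fstar_le: "\<And>y. fstar \<le> f y"
    and L: "L > 0" and smooth: "smooth_with L f"
    and x_0: "\<And>\<omega>. \<omega> \<in> space M \<Longrightarrow> x 0 \<omega> = x0"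
    and x_Suc: "\<And>t \<omega>. \<omega> \<in> space M \<Longrightarrow> x (Suc t) \<omega> = x t \<omega> - \<eta> t *\<^sub>R g t \<omega>"
    and g_meas [measurable]: "\<And>t. g t \<in> borel_measurable M"
    and e: "\<And>t \<omega>. \<omega> \<in> space M \<Longrightarrow> e t \<omega> = grad f (x t \<omega>) - g t \<omega>"
    and \<theta>: "\<theta> \<ge> 1/2" and K: "K > 0"
    and centered: "\<And>t. cond_centered M (past_algebra M e t) (e t)"
    and sub_Weibull: "\<And>t. cond_sub_Weibull M (past_algebra M e t) K \<theta> (\<lambda>\<omega>. norm (e t \<omega>))"
    and Lipschitz: "\<theta> > 1/2 \<Longrightarrow> lipschitz_on \<rho> UNIV f"
    and c: "0 < c" "c \<le> 1 / L"
    and \<eta>: "\<And>t. \<eta> t = c / sqrt (real t + 1)"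
begin

definition noise :: "nat \<Rightarrow> 'w \<Rightarrow> real" where
  "noise t \<omega> = norm (e t \<omega>) / K"

definition gradient_term :: "nat \<Rightarrow> 'w \<Rightarrow> real" where
  "gradient_term t \<omega> =
    (4 * (1 - L * \<eta> t) * (grad f (x t \<omega>) \<bullet> e t \<omega>) - (norm (grad f (x t \<omega>)))\<^sup>2) / sqrt (real t + 1)"

lemma noise_nonneg: "0 \<le> noise t \<omega>"
  using K by (simp add: noise_def)

lemma grad_measurable [measurable]: "grad f \<in> borel_measurable borel"
  using smooth unfolding smooth_with_def
  by (intro borel_measurable_continuous_onI lipschitz_on_continuous_on)

lemma x_measurable [measurable]: "x t \<in> borel_measurable M"
proof (induction t)
  case 0
  have "x 0 \<in> borel_measurable M \<longleftrightarrow> (\<lambda>_. x0) \<in> borel_measurable M"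
    by (intro measurable_cong x_0)
  then show ?case by simp
next
  case (Suc t)
  note [measurable] = Suc
  have "x (Suc t) \<in> borel_measurable M \<longleftrightarrow> (\<lambda>\<omega>. x t \<omega> - \<eta> t *\<^sub>R g t \<omega>) \<in> borel_measurable M"
    by (intro measurable_cong x_Suc)
  then show ?case by simp
qed

lemma e_measurable [measurable]: "e t \<in> borel_measurable M"
proof -
  have "e t \<in> borel_measurable M \<longleftrightarrow> (\<lambda>\<omega>. grad f (x t \<omega>) - g t \<omega>) \<in> borel_measurable M"
    by (intro measurable_cong e)
  then show ?thesis by simp
qed

lemma noise_measurable [measurable]: "noise t \<in> borel_measurable M"
  unfolding noise_def by measurable

lemma past_subalgebra: "subalgebra M (past_algebra M e t)"
  by (intro subalgebra_past_algebra e_measurable)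

lemma past_subalgebra_Suc: "subalgebra (past_algebra M e (Suc t)) (past_algebra M e t)"
  unfolding subalgebra_def sets_past_algebra
  by (intro conjI sigma_sets_mono' UN_mono) auto

lemma e_adapted: "e t \<in> borel_measurable (past_algebra M e (Suc t))"
proof (rule measurableI)
  fix A :: "(real ^ 'd) set" assume "A \<in> sets borel"
  then show "e t -` A \<inter> space (past_algebra M e (Suc t)) \<in> sets (past_algebra M e (Suc t))"
    unfolding sets_past_algebra by (auto intro!: sigma_sets.Basic)
qed simp

lemma x_predictable: "x t \<in> borel_measurable (past_algebra M e t)"
proof (induction t)
  case 0
  have "x 0 \<in> borel_measurable (past_algebra M e 0) \<longleftrightarrow> (\<lambda>_. x0) \<in> borel_measurable (past_algebra M e 0)"
    by (intro measurable_cong) (simp add: x_0)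
  then show ?case by simp
next
  case (Suc t)
  note [measurable] = measurable_from_subalg[OF past_subalgebra_Suc Suc] e_adapted
  have "x (Suc t) \<in> borel_measurable (past_algebra M e (Suc t)) \<longleftrightarrow>
      (\<lambda>\<omega>. x t \<omega> - \<eta> t *\<^sub>R (grad f (x t \<omega>) - e t \<omega>)) \<in> borel_measurable (past_algebra M e (Suc t))"
    by (intro measurable_cong) (simp add: x_Suc e)
  then show ?case by simp
qed

lemma noise_cond_sub_Weibull:
  "AE \<omega> in M. nn_cond_exp M (past_algebra M e t) (\<lambda>\<omega>. ennreal (exp (noise t \<omega> powr (1 / \<theta>)))) \<omega> \<le> 2"
  using sub_Weibull[of t] by (simp add: cond_sub_Weibull_def noise_def)

lemma noise_sub_Weibull: "(\<integral>\<^sup>+\<omega>. ennreal (exp (noise t \<omega> powr (1 / \<theta>))) \<partial>M) \<le> 2"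
proof -
  interpret finite_measure_subalgebra M "past_algebra M e t" by standard (rule past_subalgebra)
  have "(\<integral>\<^sup>+\<omega>. ennreal (exp (noise t \<omega> powr (1 / \<theta>))) \<partial>M)
      = (\<integral>\<^sup>+\<omega>. 1 * ennreal (exp (noise t \<omega> powr (1 / \<theta>))) \<partial>M)" by simp
  also have "\<dots> = (\<integral>\<^sup>+\<omega>. 1 * nn_cond_exp M (past_algebra M e t) (\<lambda>\<omega>. ennreal (exp (noise t \<omega> powr (1 / \<theta>)))) \<omega> \<partial>M)"
    by (rule nn_cond_exp_intg[symmetric]) measurable
  also have "\<dots> \<le> (\<integral>\<^sup>+\<omega>. 2 \<partial>M)"
    using noise_cond_sub_Weibull[of t] by (intro nn_integral_mono_AE) simp
  also have "\<dots> = 2" by (simp add: emeasure_space_1)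
  finally show ?thesis .
qed

text \<open>\<open>|e t|\<close> is bounded by a multiple of one plus the sub-Weibull weight, which is integrable. Only for an
  integrable \<open>e t\<close> does a vanishing \<open>real_cond_exp\<close> say that integrals against bounded predictable
  functions vanish.\<close>

lemma e_integrable: "integrable M (e t)"
proof -
  define C where "C = 2 powr (2 * \<theta>) * Gamma (2 * \<theta> + 1)"
  have C: "C \<ge> 0" unfolding C_def using \<theta> by (intro mult_nonneg_nonneg Gamma_real_nonneg) auto
  have int: "integrable M (\<lambda>\<omega>. exp (noise t \<omega> powr (1 / \<theta>)))"
    using noise_sub_Weibull[of t]
    by (intro integrableI_bounded) (auto simp: less_top[symmetric] top_unique)
  show ?thesis
  proof (rule Bochner_Integration.integrable_bound)
    show "integrable M (\<lambda>\<omega>. K * (1 + C * exp (noise t \<omega> powr (1 / \<theta>))))" using int by simp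
    show "AE \<omega> in M. norm (e t \<omega>) \<le> norm (K * (1 + C * exp (noise t \<omega> powr (1 / \<theta>))))"
    proof (intro AE_I2)
      fix \<omega>
      have "noise t \<omega> \<le> 1 + (noise t \<omega>)\<^sup>2"
        using zero_le_power2[of "noise t \<omega> - 1"] noise_nonneg[of t \<omega>]
        by (simp add: power2_eq_square algebra_simps)
      also have "(noise t \<omega>)\<^sup>2 \<le> C * exp (noise t \<omega> powr (1 / \<theta>) / 2)"
        unfolding C_def using noise_nonneg \<theta> by (intro square_le_Gamma_exp) auto
      also have "\<dots> \<le> C * exp (noise t \<omega> powr (1 / \<theta>))" using C by (intro mult_left_mono) auto
      finally have "K * noise t \<omega> \<le> K * (1 + C * exp (noise t \<omega> powr (1 / \<theta>)))"
        using K by (intro mult_left_mono) auto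
      then show "norm (e t \<omega>) \<le> norm (K * (1 + C * exp (noise t \<omega> powr (1 / \<theta>))))"
        using K C by (simp add: noise_def)
    qed
  qed measurable
qed

lemma step_factor: "0 \<le> 1 - L * \<eta> t" "1 - L * \<eta> t \<le> 1"
proof -
  have "c / sqrt (real t + 1) \<le> c / 1" using c by (intro divide_left_mono) auto
  then have "L * \<eta> t \<le> L * c" unfolding \<eta> using L by (intro mult_left_mono) auto
  also have "\<dots> \<le> 1" using c L by (simp add: field_simps)
  finally show "0 \<le> 1 - L * \<eta> t" by simp
  show "1 - L * \<eta> t \<le> 1" using L c by (simp add: \<eta>)
qed

text \<open>Dividing by \<open>\<gamma>(\<theta>)\<close> meets both demands of \<open>gam_dominates\<close> on \<open>s = \<kappa> K |G|\<close>, where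
  \<open>\<kappa> = 4 a u / \<gamma>(\<theta>)\<close>: the product \<open>s \<gamma>(\<theta>)\<close> is at most \<open>4 K \<rho>\<close> if \<open>|G| \<le> \<rho>\<close>, and
  \<open>C s\<^sup>2 \<le> a |G|\<^sup>2 / \<gamma>(\<theta>)\<close> because \<open>16 C K\<^sup>2 \<le> \<gamma>(\<theta>)\<close> and \<open>a\<^sup>2 \<le> a\<close>.\<close>

lemma gradient_term_mgf:
  assumes T: "T \<ge> 1" and \<delta>\<^sub>2: "\<delta>\<^sub>2 \<in> {0<..<1}"
  shows "(\<integral>\<^sup>+\<omega>. ennreal (\<Prod>t<n. if \<theta> \<le> 1 \<or> noise t \<omega> \<le> tail_cutoff \<delta>\<^sub>2 \<theta> T
    then exp (gradient_term t \<omega> / gam K \<rho> \<delta>\<^sub>2 \<theta> T) else 0) \<partial>M) \<le> 1"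
proof -
  define \<gamma> where "\<gamma> = gam K \<rho> \<delta>\<^sub>2 \<theta> T"
  have \<rho>: "\<rho> \<ge> 0" if "\<theta> > 1/2" using Lipschitz[OF that] lipschitz_on_nonneg by blast
  obtain C :: real and h :: "real \<Rightarrow> real"
    where h [measurable]: "h \<in> borel_measurable borel" and h0: "\<And>s. 0 \<le> h s"
      and h_exp: "\<And>s. 1 + 2 * h s \<le> exp (C * s\<^sup>2)" and C: "C > 0" "16 * C * K\<^sup>2 \<le> \<gamma>"
      and dom: "\<And>s v y. \<lbrakk>0 \<le> s; 0 \<le> y; \<bar>v\<bar> \<le> s * y; \<theta> > 1/2 \<Longrightarrow> s * \<gamma> \<le> 4 * K * \<rho>\<rbrakk> \<Longrightarrow>
       (if \<theta> \<le> 1 \<or> y \<le> tail_cutoff \<delta>\<^sub>2 \<theta> T then exp v else 0) \<le> 1 + v + h s * exp (y powr (1 / \<theta>))"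
    unfolding \<gamma>_def by (rule gam_dominates[OF \<theta> K \<rho> T \<delta>\<^sub>2]) (assumption | blast)+
  have "0 < 16 * C * K\<^sup>2" using C K by simp
  then have \<gamma>: "\<gamma> > 0" using C by linarith
  define \<kappa> where "\<kappa> t = 4 * (1 - L * \<eta> t) / (\<gamma> * sqrt (real t + 1))" for t
  have \<kappa>: "0 \<le> \<kappa> t" "\<kappa> t * \<gamma> \<le> 4" "\<kappa> t * \<gamma> = 4 * (1 - L * \<eta> t) / sqrt (real t + 1)" for t
  proof -
    show "0 \<le> \<kappa> t" using step_factor[of t] \<gamma> by (simp add: \<kappa>_def)
    show *: "\<kappa> t * \<gamma> = 4 * (1 - L * \<eta> t) / sqrt (real t + 1)" using \<gamma> by (simp add: \<kappa>_def)
    have "4 * (1 - L * \<eta> t) / sqrt (real t + 1) \<le> 4 * 1 / 1"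
      using step_factor[of t] by (intro frac_le) auto
    then show "\<kappa> t * \<gamma> \<le> 4" unfolding * by simp
  qed
  define G where "G t \<omega> = grad f (x t \<omega>)" for t \<omega>
  have G_le: "norm (G t \<omega>) \<le> \<rho>" if "\<theta> > 1/2" for t \<omega>
    unfolding G_def by (rule norm_grad_le_lipschitz[OF diff Lipschitz[OF that]])
  define s where "s t \<omega> = \<kappa> t * K * norm (G t \<omega>)" for t \<omega>
  define r where "r t \<omega> = exp (- ((norm (G t \<omega>))\<^sup>2 / sqrt (real t + 1) / \<gamma>))" for t \<omega>
  define N where "N t \<omega> = (if \<theta> \<le> 1 \<or> noise t \<omega> \<le> tail_cutoff \<delta>\<^sub>2 \<theta> T
    then exp ((\<kappa> t *\<^sub>R G t \<omega>) \<bullet> e t \<omega>) else 0)" for t \<omega>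
  note [measurable] = x_predictable
  have G_meas [measurable]: "G t \<in> borel_measurable (past_algebra M e t)" for t
    unfolding G_def by measurable
  have N_meas: "N t \<in> borel_measurable (past_algebra M e (Suc t))" for t
  proof -
    note [measurable] = measurable_from_subalg[OF past_subalgebra_Suc G_meas] e_adapted
    show ?thesis unfolding N_def noise_def by measurable
  qed
  have "(\<integral>\<^sup>+\<omega>. ennreal (\<Prod>t<n. r t \<omega> * N t \<omega>) \<partial>M) \<le> 1"
  proof (rule exponential_supermartingale[where F = "past_algebra M e" and e = e and U = "\<lambda>t \<omega>. \<kappa> t *\<^sub>R G t \<omega>"
        and h = "\<lambda>t \<omega>. h (s t \<omega>)" and E = "\<lambda>t \<omega>. exp (noise t \<omega> powr (1 / \<theta>))"])
    fix t \<omega>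
    have s0: "0 \<le> s t \<omega>" using \<kappa> K by (simp add: s_def)
    show "N t \<omega> \<le> 1 + (\<kappa> t *\<^sub>R G t \<omega>) \<bullet> e t \<omega> + h (s t \<omega>) * exp (noise t \<omega> powr (1 / \<theta>))"
      unfolding N_def
    proof (rule dom[OF s0 noise_nonneg])
      have "\<bar>(\<kappa> t *\<^sub>R G t \<omega>) \<bullet> e t \<omega>\<bar> \<le> norm (\<kappa> t *\<^sub>R G t \<omega>) * norm (e t \<omega>)"
        by (rule Cauchy_Schwarz_ineq2)
      also have "\<dots> = s t \<omega> * noise t \<omega>" using K \<kappa>(1) by (simp add: s_def noise_def)
      finally show "\<bar>(\<kappa> t *\<^sub>R G t \<omega>) \<bullet> e t \<omega>\<bar> \<le> s t \<omega> * noise t \<omega>" .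
      assume "\<theta> > 1/2"
      then have "(\<kappa> t * \<gamma>) * (K * norm (G t \<omega>)) \<le> 4 * (K * \<rho>)"
        using \<kappa>(2) \<gamma> K G_le[of t \<omega>] by (intro mult_mono) auto
      then show "s t \<omega> * \<gamma> \<le> 4 * K * \<rho>" by (simp add: s_def mult_ac)
    qed
    show "r t \<omega> * (1 + 2 * h (s t \<omega>)) \<le> 1"
    proof -
      define a where "a = 1 / sqrt (real t + 1)"
      have a: "0 \<le> a" "a \<le> 1" by (auto simp: a_def)
      have \<kappa>a: "\<kappa> t * \<gamma> \<le> 4 * a"
        unfolding \<kappa>(3) using step_factor[of t] by (simp add: a_def divide_right_mono)
      have "C * (s t \<omega>)\<^sup>2 * \<gamma> * 16 = (16 * C * K\<^sup>2) * (\<kappa> t)\<^sup>2 * \<gamma> * (norm (G t \<omega>))\<^sup>2"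
        by (simp add: s_def power_mult_distrib)
      also have "\<dots> \<le> \<gamma> * (\<kappa> t)\<^sup>2 * \<gamma> * (norm (G t \<omega>))\<^sup>2"
        using C(2) \<gamma> by (intro mult_right_mono) auto
      also have "\<dots> = (\<kappa> t * \<gamma>) * (\<kappa> t * \<gamma>) * (norm (G t \<omega>))\<^sup>2" by (simp add: power2_eq_square)
      also have "\<dots> \<le> (4 * a) * 4 * (norm (G t \<omega>))\<^sup>2"
      proof (rule mult_right_mono)
        show "(\<kappa> t * \<gamma>) * (\<kappa> t * \<gamma>) \<le> (4 * a) * 4"
        using \<kappa>(1)[of t] \<gamma> a by (intro mult_mono[OF \<kappa>a \<kappa>(2)]) auto
      qed simp
      finally have "C * (s t \<omega>)\<^sup>2 * \<gamma> \<le> a * (norm (G t \<omega>))\<^sup>2" by simp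
      then have "C * (s t \<omega>)\<^sup>2 \<le> (norm (G t \<omega>))\<^sup>2 / sqrt (real t + 1) / \<gamma>"
        using \<gamma> by (simp add: a_def pos_le_divide_eq mult_ac)
      then have "exp (C * (s t \<omega>)\<^sup>2) \<le> exp ((norm (G t \<omega>))\<^sup>2 / sqrt (real t + 1) / \<gamma>)" by simp
      then have "1 + 2 * h (s t \<omega>) \<le> exp ((norm (G t \<omega>))\<^sup>2 / sqrt (real t + 1) / \<gamma>)"
        using h_exp[of "s t \<omega>"] by linarith
      then have "r t \<omega> * (1 + 2 * h (s t \<omega>)) \<le> r t \<omega> * exp ((norm (G t \<omega>))\<^sup>2 / sqrt (real t + 1) / \<gamma>)"
        by (intro mult_left_mono) (auto simp: r_def)
      then show ?thesis by (simp add: r_def flip: exp_add)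
    qed
  next
    show "(\<lambda>\<omega>. h (s t \<omega>)) \<in> borel_measurable (past_algebra M e t)" for t
      unfolding s_def by measurable
    show "r t \<in> borel_measurable (past_algebra M e t)" for t unfolding r_def by measurable
    show "N t \<in> borel_measurable (past_algebra M e (Suc t))" for t by (rule N_meas)
    show "AE \<omega> in M. nn_cond_exp M (past_algebra M e t) (\<lambda>\<omega>. ennreal (exp (noise t \<omega> powr (1 / \<theta>)))) \<omega> \<le> 2" for t
      by (rule noise_cond_sub_Weibull)
  qed (use past_subalgebra past_subalgebra_Suc e_integrable centered h0 in \<open>auto simp: r_def N_def\<close>)
  moreover have "r t \<omega> * N t \<omega> = (if \<theta> \<le> 1 \<or> noise t \<omega> \<le> tail_cutoff \<delta>\<^sub>2 \<theta> T
    then exp (gradient_term t \<omega> / \<gamma>) else 0)" for t \<omega>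
  proof -
    define v where "v = 1 - L * \<eta> t"
    have "- ((norm (G t \<omega>))\<^sup>2 / sqrt (real t + 1) / \<gamma>) + (\<kappa> t *\<^sub>R G t \<omega>) \<bullet> e t \<omega> = gradient_term t \<omega> / \<gamma>"
      unfolding gradient_term_def \<kappa>_def G_def v_def[symmetric]
      by (simp add: diff_divide_distrib mult_ac)
    then show ?thesis by (simp add: r_def N_def flip: exp_add)
  qed
  ultimately show ?thesis unfolding \<gamma>_def by simp
qed

lemma gam_pos:
  assumes "T \<ge> 1" "\<delta>\<^sub>2 \<in> {0<..<1}"
  shows "0 < gam K \<rho> \<delta>\<^sub>2 \<theta> T"
proof -
  have \<rho>: "\<rho> \<ge> 0" if "\<theta> > 1/2" using Lipschitz[OF that] lipschitz_on_nonneg by blast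
  obtain C :: real where "C > 0" "16 * C * K\<^sup>2 \<le> gam K \<rho> \<delta>\<^sub>2 \<theta> T"
    by (rule gam_dominates[OF \<theta> K \<rho> assms])
  moreover have "0 < 16 * C * K\<^sup>2" using \<open>C > 0\<close> K by simp
  ultimately show ?thesis by linarith
qed

text \<open>Markov's inequality for the product of the exponentials. On this event none of the factors has
  been replaced by \<open>0\<close>.\<close>

lemma gradient_term_tail:
  assumes T: "T \<ge> 1" and \<delta>\<^sub>2: "\<delta>\<^sub>2 \<in> {0<..<1}" and \<delta>\<^sub>3: "\<delta>\<^sub>3 \<in> {0<..<1}"
  shows "prob {\<omega> \<in> space M. (\<forall>t<T. \<theta> \<le> 1 \<or> noise t \<omega> \<le> tail_cutoff \<delta>\<^sub>2 \<theta> T) \<and>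
      gam K \<rho> \<delta>\<^sub>2 \<theta> T * ln (1 / \<delta>\<^sub>3) < (\<Sum>t<T. gradient_term t \<omega>)} \<le> \<delta>\<^sub>3"
proof -
  define \<gamma> where "\<gamma> = gam K \<rho> \<delta>\<^sub>2 \<theta> T"
  have \<gamma>: "\<gamma> > 0" unfolding \<gamma>_def by (rule gam_pos[OF T \<delta>\<^sub>2])
  define P where "P \<omega> = (\<Prod>t<T. if \<theta> \<le> 1 \<or> noise t \<omega> \<le> tail_cutoff \<delta>\<^sub>2 \<theta> T
    then exp (gradient_term t \<omega> / \<gamma>) else 0)" for \<omega>
  have [measurable]: "P \<in> borel_measurable M"
    unfolding P_def gradient_term_def by measurable
  let ?A = "{\<omega> \<in> space M. (\<forall>t<T. \<theta> \<le> 1 \<or> noise t \<omega> \<le> tail_cutoff \<delta>\<^sub>2 \<theta> T) \<and>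
      \<gamma> * ln (1 / \<delta>\<^sub>3) < (\<Sum>t<T. gradient_term t \<omega>)}"
  have "emeasure M ?A \<le> emeasure M {\<omega> \<in> space M. 1 \<le> ennreal \<delta>\<^sub>3 * ennreal (P \<omega>)}"
  proof (intro emeasure_mono subsetI CollectI conjI)
    fix \<omega> assume \<omega>: "\<omega> \<in> ?A"
    then show "\<omega> \<in> space M" by simp
    have "P \<omega> = (\<Prod>t<T. exp (gradient_term t \<omega> / \<gamma>))"
      unfolding P_def using \<omega> by (intro prod.cong) auto
    also have "\<dots> = exp ((\<Sum>t<T. gradient_term t \<omega>) / \<gamma>)" by (simp add: exp_sum sum_divide_distrib)
    finally have P: "P \<omega> = \<dots>" .
    have "ln (1 / \<delta>\<^sub>3) \<le> (\<Sum>t<T. gradient_term t \<omega>) / \<gamma>"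
      using \<omega> \<gamma> by (simp add: pos_le_divide_eq mult.commute)
    then have "exp (ln (1 / \<delta>\<^sub>3)) \<le> P \<omega>" unfolding P by simp
    then have "1 \<le> \<delta>\<^sub>3 * P \<omega>" using \<delta>\<^sub>3 by (simp add: field_simps)
    then show "1 \<le> ennreal \<delta>\<^sub>3 * ennreal (P \<omega>)" using \<delta>\<^sub>3 by (simp flip: ennreal_mult')
  qed simp
  also have "\<dots> \<le> ennreal \<delta>\<^sub>3 * (\<integral>\<^sup>+\<omega>. ennreal (P \<omega>) * indicator (space M) \<omega> \<partial>M)"
    by (rule nn_integral_Markov_inequality) auto
  also have "(\<integral>\<^sup>+\<omega>. ennreal (P \<omega>) * indicator (space M) \<omega> \<partial>M) = (\<integral>\<^sup>+\<omega>. ennreal (P \<omega>) \<partial>M)"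
    by (intro nn_integral_cong) simp
  also have "ennreal \<delta>\<^sub>3 * \<dots> \<le> ennreal \<delta>\<^sub>3 * 1"
    using gradient_term_mgf[OF T \<delta>\<^sub>2, of T] unfolding P_def \<gamma>_def by (rule mult_left_mono) simp
  finally have "emeasure M ?A \<le> ennreal \<delta>\<^sub>3" by simp
  then show ?thesis using \<delta>\<^sub>3 by (simp add: emeasure_eq_measure \<gamma>_def)
qed

text \<open>The cutoff is chosen so that each of the \<open>T\<close> tails is at most \<open>2 exp (- ln (2 T / \<delta>\<^sub>2)) = \<delta>\<^sub>2 / T\<close>.\<close>

lemma noise_exceeds_cutoff:
  assumes T: "T \<ge> 1" and \<delta>\<^sub>2: "\<delta>\<^sub>2 \<in> {0<..<1}"
  shows "prob (\<Union>t<T. {\<omega> \<in> space M. tail_cutoff \<delta>\<^sub>2 \<theta> T < noise t \<omega>}) \<le> \<delta>\<^sub>2"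
proof -
  define b where "b = ln (2 * real T / \<delta>\<^sub>2)"
  have b: "0 < b" unfolding b_def by (rule ln_two_T_pos[OF T \<delta>\<^sub>2])
  have eb: "exp (- b) = \<delta>\<^sub>2 / (2 * real T)" using T \<delta>\<^sub>2 by (simp add: b_def exp_minus)
  have "prob (\<Union>t<T. {\<omega> \<in> space M. tail_cutoff \<delta>\<^sub>2 \<theta> T < noise t \<omega>})
      \<le> (\<Sum>t<T. prob {\<omega> \<in> space M. tail_cutoff \<delta>\<^sub>2 \<theta> T < noise t \<omega>})"
    by (intro finite_measure_subadditive_finite) auto
  also have "\<dots> \<le> (\<Sum>t<T. 2 * exp (- b))"
    unfolding tail_cutoff_def b_def[symmetric]
    using \<theta> b by (intro sum_mono sub_Weibull_tail noise_sub_Weibull) (auto simp: noise_nonneg)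
  also have "\<dots> = \<delta>\<^sub>2" using T by (simp add: eb)
  finally show ?thesis .
qed

lemma sum_noise_tail:
  assumes T: "T \<ge> 1" and \<delta>\<^sub>1: "\<delta>\<^sub>1 \<in> {0<..<1}"
  shows "prob {\<omega> \<in> space M. (\<Sum>t<T. 1 / (real t + 1)) * (4 * exp 1 * \<theta> * ln (2 / \<delta>\<^sub>1)) powr (2 * \<theta>)
      < (\<Sum>t<T. 1 / (real t + 1) * (noise t \<omega>)\<^sup>2)} \<le> \<delta>\<^sub>1"
  using T by (intro weighted_sum_sub_Weibull_tail noise_sub_Weibull \<theta> \<delta>\<^sub>1 sum_pos)
    (auto simp: noise_nonneg lessThan_empty_iff)

text \<open>A union bound over the three exceptional events; outside them the bounds on the three sums add up.\<close>

lemma high_probability_bound: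
  assumes T: "T \<ge> 1" and \<delta>s: "\<delta>\<^sub>1 \<in> {0<..<1}" "\<delta>\<^sub>2 \<in> {0<..<1}" "\<delta>\<^sub>3 \<in> {0<..<1}"
  shows "1 - \<delta>\<^sub>1 - \<delta>\<^sub>2 - \<delta>\<^sub>3 \<le> \<P>(\<omega> in M.
      1 / sqrt (real T) * (\<Sum>t<T. 1 / sqrt (real t + 1) * (norm (grad f (x t \<omega>)))\<^sup>2)
        \<le> sgd_bound L c K \<rho> \<theta> (f x0 - fstar) \<delta>\<^sub>1 \<delta>\<^sub>2 \<delta>\<^sub>3 T)"
proof -
  define s where "s = (4 * exp 1 * \<theta> * ln (2 / \<delta>\<^sub>1)) powr (2 * \<theta>)"
  define \<gamma> where "\<gamma> = gam K \<rho> \<delta>\<^sub>2 \<theta> T"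
  define W where "W = (\<Sum>t<T. 1 / (real t + 1))"
  define B1 where "B1 = {\<omega> \<in> space M. W * s < (\<Sum>t<T. 1 / (real t + 1) * (noise t \<omega>)\<^sup>2)}"
  define B2 where "B2 = (\<Union>t<T. {\<omega> \<in> space M. tail_cutoff \<delta>\<^sub>2 \<theta> T < noise t \<omega>})"
  define B3 where "B3 = {\<omega> \<in> space M. (\<forall>t<T. \<theta> \<le> 1 \<or> noise t \<omega> \<le> tail_cutoff \<delta>\<^sub>2 \<theta> T) \<and>
      \<gamma> * ln (1 / \<delta>\<^sub>3) < (\<Sum>t<T. gradient_term t \<omega>)}"
  have gt [measurable]: "gradient_term t \<in> borel_measurable M" for t unfolding gradient_term_def by measurable
  have [measurable]: "B1 \<in> sets M" "B2 \<in> sets M" "B3 \<in> sets M"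
    unfolding B1_def B2_def B3_def by measurable
  let ?good = "{\<omega> \<in> space M. 1 / sqrt (real T) * (\<Sum>t<T. 1 / sqrt (real t + 1) * (norm (grad f (x t \<omega>)))\<^sup>2)
        \<le> sgd_bound L c K \<rho> \<theta> (f x0 - fstar) \<delta>\<^sub>1 \<delta>\<^sub>2 \<delta>\<^sub>3 T}"
  have "space M - (B1 \<union> B2 \<union> B3) \<subseteq> ?good"
  proof (intro subsetI CollectI conjI)
    fix \<omega> assume \<omega>: "\<omega> \<in> space M - (B1 \<union> B2 \<union> B3)"
    then show "\<omega> \<in> space M" by simp
    have gradient: "(\<Sum>t<T. gradient_term t \<omega>) \<le> \<gamma> * ln (1 / \<delta>\<^sub>3)"
      using \<omega> by (auto simp: B2_def B3_def not_less)
    have "(\<Sum>t<T. 1 / (real t + 1) * (norm (e t \<omega>))\<^sup>2) = K\<^sup>2 * (\<Sum>t<T. 1 / (real t + 1) * (noise t \<omega>)\<^sup>2)"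
      using K by (simp add: noise_def sum_distrib_left power_divide)
    also have "\<dots> \<le> K\<^sup>2 * (W * s)" using \<omega> by (intro mult_left_mono) (auto simp: B1_def not_less)
    also have "\<dots> \<le> K\<^sup>2 * (2 * ln (real T + 1) * s)"
      unfolding W_def by (intro mult_left_mono mult_right_mono harmonic_le_ln) (auto simp: s_def)
    finally have noise: "2 * L * c * (\<Sum>t<T. 1 / (real t + 1) * (norm (e t \<omega>))\<^sup>2)
        \<le> 2 * L * c * (K\<^sup>2 * (2 * ln (real T + 1) * s))"
      using L c by (intro mult_left_mono) auto
    have x00: "x 0 \<omega> = x0" using \<omega> by (simp add: x_0)
    have "(\<Sum>t<T. 1 / sqrt (real t + 1) * (norm (grad f (x t \<omega>)))\<^sup>2)
      \<le> 4 / c * (f (x 0 \<omega>) - fstar) + (\<Sum>t<T. gradient_term t \<omega>)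
        + 2 * L * c * (\<Sum>t<T. 1 / (real t + 1) * (norm (e t \<omega>))\<^sup>2)"
      unfolding gradient_term_def
      using \<omega> by (intro sgd_sum_decrease[OF diff smooth L c \<eta>, where g = "\<lambda>t. g t \<omega>"] x_Suc e fstar_le) auto
    then have main: "(\<Sum>t<T. 1 / sqrt (real t + 1) * (norm (grad f (x t \<omega>)))\<^sup>2)
      \<le> 4 / c * (f x0 - fstar) + \<gamma> * ln (1 / \<delta>\<^sub>3) + 2 * L * c * (K\<^sup>2 * (2 * ln (real T + 1) * s))"
      using gradient noise unfolding x00 by linarith
    have "sgd_bound L c K \<rho> \<theta> (f x0 - fstar) \<delta>\<^sub>1 \<delta>\<^sub>2 \<delta>\<^sub>3 T
      = 1 / sqrt (real T) * (4 / c * (f x0 - fstar) + \<gamma> * ln (1 / \<delta>\<^sub>3) + 2 * L * c * (K\<^sup>2 * (2 * ln (real T + 1) * s)))"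
      by (simp add: sgd_bound_def \<gamma>_def s_def add_divide_distrib mult_ac)
    then show "1 / sqrt (real T) * (\<Sum>t<T. 1 / sqrt (real t + 1) * (norm (grad f (x t \<omega>)))\<^sup>2)
        \<le> sgd_bound L c K \<rho> \<theta> (f x0 - fstar) \<delta>\<^sub>1 \<delta>\<^sub>2 \<delta>\<^sub>3 T"
      using main by (simp only:) (intro mult_left_mono, auto)
  qed
  moreover have "?good \<in> sets M" by measurable
  ultimately have "prob (space M - (B1 \<union> B2 \<union> B3)) \<le> prob ?good"
    by (intro finite_measure_mono) auto
  moreover have "prob (space M - (B1 \<union> B2 \<union> B3)) = 1 - prob (B1 \<union> B2 \<union> B3)"
    by (rule prob_compl) measurable
  moreover have "prob (B1 \<union> B2 \<union> B3) \<le> prob B1 + prob B2 + prob B3"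
    using measure_Un_le[of "B1 \<union> B2" M B3] measure_Un_le[of B1 M B2] by simp
  moreover have "prob B1 \<le> \<delta>\<^sub>1" unfolding B1_def W_def s_def by (rule sum_noise_tail[OF T \<delta>s(1)])
  moreover have "prob B2 \<le> \<delta>\<^sub>2" unfolding B2_def by (rule noise_exceeds_cutoff[OF T \<delta>s(2)])
  moreover have "prob B3 \<le> \<delta>\<^sub>3" unfolding B3_def \<gamma>_def by (rule gradient_term_tail[OF T \<delta>s(2,3)])
  ultimately show ?thesis by linarith
qed

end

section \<open>Order of magnitude of the bound\<close>

lemma one_le_ln:
  assumes "T \<ge> 3" shows "1 \<le> ln (real T)"
proof -
  have "exp 1 \<le> real T" using exp_le assms by linarith
  then show ?thesis using assms by (subst ln_ge_iff) auto
qed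

lemma sgd_bound_bigo:
  fixes \<theta> :: real
  assumes gam: "\<And>T. T \<ge> 1 \<Longrightarrow> 0 \<le> gam K \<rho> \<delta>\<^sub>2 \<theta> T"
    and \<delta>\<^sub>3: "\<delta>\<^sub>3 \<in> {0<..<1}" and \<delta>: "\<delta> \<in> {0<..<1}"
  shows "(\<lambda>T. sgd_bound L c K \<rho> \<theta> \<Delta> \<delta>\<^sub>1 \<delta>\<^sub>2 \<delta>\<^sub>3 T)
    \<in> O(\<lambda>T. (ln (real T) * ln (1 / \<delta>) powr (2 * \<theta>) + gam K \<rho> \<delta>\<^sub>2 \<theta> T * ln (1 / \<delta>)) / sqrt (real T))"
proof -
  define B where "B = ln (1 / \<delta>)"
  define A where "A = B powr (2 * \<theta>)"
  define P where "P = \<bar>4 * \<Delta> / c\<bar>"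
  define Q where "Q = \<bar>4 * L * K\<^sup>2 * c * (4 * exp 1 * \<theta> * ln (2 / \<delta>\<^sub>1)) powr (2 * \<theta>)\<bar>"
  define D where "D = ln (1 / \<delta>\<^sub>3)"
  have B: "B > 0" and D: "D \<ge> 0" using \<delta> \<delta>\<^sub>3 by (auto simp: B_def D_def)
  have A: "A > 0" using B by (simp add: A_def)
  have PQ: "P \<ge> 0" "Q \<ge> 0" by (auto simp: P_def Q_def)
  show ?thesis
  proof (rule bigoI[where c = "(P + 2 * Q) / A + D / B"])
    show "\<forall>\<^sub>F T in sequentially. norm (sgd_bound L c K \<rho> \<theta> \<Delta> \<delta>\<^sub>1 \<delta>\<^sub>2 \<delta>\<^sub>3 T)
      \<le> ((P + 2 * Q) / A + D / B) * norm ((ln (real T) * ln (1 / \<delta>) powr (2 * \<theta>) + gam K \<rho> \<delta>\<^sub>2 \<theta> T * ln (1 / \<delta>)) / sqrt (real T))"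
      using eventually_ge_at_top[of 3]
    proof eventually_elim
      case (elim T)
      define G where "G = gam K \<rho> \<delta>\<^sub>2 \<theta> T"
      define l where "l = ln (real T)"
      have G: "G \<ge> 0" unfolding G_def using gam elim by simp
      have l: "1 \<le> l" unfolding l_def by (rule one_le_ln[OF elim])
      have "ln (real T + 1) \<le> ln (real T * real T)"
      proof (intro ln_mono)
        have "real T + 1 \<le> real T * 3" using elim by simp
        also have "\<dots> \<le> real T * real T" using elim by (intro mult_left_mono) auto
        finally show "real T + 1 \<le> real T * real T" .
      qed (use elim in auto)
      then have l1: "ln (real T + 1) \<le> 2 * l" "0 \<le> ln (real T + 1)"
        using elim by (auto simp: ln_mult l_def)
      have "sgd_bound L c K \<rho> \<theta> \<Delta> \<delta>\<^sub>1 \<delta>\<^sub>2 \<delta>\<^sub>3 T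
        = (4 * \<Delta> / c + G * D + 4 * L * K\<^sup>2 * c * (4 * exp 1 * \<theta> * ln (2 / \<delta>\<^sub>1)) powr (2 * \<theta>) * ln (real T + 1)) / sqrt (real T)"
        by (simp add: sgd_bound_def G_def D_def add_divide_distrib)
      also have "norm \<dots> \<le> (P + G * D + Q * ln (real T + 1)) / sqrt (real T)"
      proof -
        have "\<bar>4 * \<Delta> / c + G * D + 4 * L * K\<^sup>2 * c * (4 * exp 1 * \<theta> * ln (2 / \<delta>\<^sub>1)) powr (2 * \<theta>) * ln (real T + 1)\<bar>
          \<le> P + \<bar>G * D\<bar> + Q * \<bar>ln (real T + 1)\<bar>"
          unfolding P_def Q_def abs_mult[of _ "ln (real T + 1)", symmetric] by linarith
        then show ?thesis using G D l1(2) by (simp add: divide_right_mono)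
      qed
      also have "\<dots> \<le> (P * l + G * D + Q * (2 * l)) / sqrt (real T)"
        using mult_left_mono[OF l PQ(1)] mult_left_mono[OF l1(1) PQ(2)]
        by (intro divide_right_mono) auto
      also have "\<dots> \<le> (((P + 2 * Q) / A + D / B) * (l * A + G * B)) / sqrt (real T)"
      proof (intro divide_right_mono)
        have "((P + 2 * Q) / A + D / B) * (l * A + G * B)
          = P * l + G * D + Q * (2 * l) + ((P + 2 * Q) / A * (G * B) + D / B * (l * A))"
          using A B by (simp add: field_simps)
        moreover have "0 \<le> (P + 2 * Q) / A * (G * B) + D / B * (l * A)"
          using A B G D l PQ by (intro add_nonneg_nonneg mult_nonneg_nonneg divide_nonneg_nonneg) auto
        ultimately show "P * l + G * D + Q * (2 * l) \<le> ((P + 2 * Q) / A + D / B) * (l * A + G * B)" by linarith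
      qed simp
      also have "\<dots> = ((P + 2 * Q) / A + D / B) * norm ((l * A + G * B) / sqrt (real T))"
        using A B G l by simp
      finally show ?case by (simp add: l_def A_def B_def G_def)
    qed
  qed
qed

text \<open>For \<open>\<theta> > 1\<close> the two logarithms are comparable: \<open>1 \<le> ln (2 T / \<delta>\<^sub>2) \<le> 2 ln (T / \<delta>)\<close> once \<open>T \<ge> 2 / \<delta>\<^sub>2\<close>
  and \<open>T \<ge> 3\<close>.\<close>

lemma gam_bigo:
  fixes \<theta> :: real
  assumes \<theta>: "\<theta> \<ge> 1/2" and K: "K > 0" and \<rho>: "\<theta> > 1/2 \<Longrightarrow> \<rho> \<ge> 0"
    and \<delta>\<^sub>2: "\<delta>\<^sub>2 \<in> {0<..<1}" and \<delta>: "\<delta> \<in> {0<..<1}"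
  shows "(\<lambda>T. gam K \<rho> \<delta>\<^sub>2 \<theta> T) \<in> O(\<lambda>T. ln (real T / \<delta>) powr max 0 (\<theta> - 1))"
proof -
  have ln\<delta>: "ln (real T) \<le> ln (real T / \<delta>)" if "T \<ge> 1" for T
    using that \<delta> by (intro ln_mono) (auto simp: field_simps)
  show ?thesis
  proof (cases "\<theta> \<le> 1")
    case True
    show ?thesis
    proof (rule bigoI[where c = "\<bar>gam K \<rho> \<delta>\<^sub>2 \<theta> 1\<bar>"])
      show "\<forall>\<^sub>F T in sequentially. norm (gam K \<rho> \<delta>\<^sub>2 \<theta> T)
          \<le> \<bar>gam K \<rho> \<delta>\<^sub>2 \<theta> 1\<bar> * norm (ln (real T / \<delta>) powr max 0 (\<theta> - 1))"
        using eventually_ge_at_top[of 3]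
      proof eventually_elim
        case (elim T)
        have "1 \<le> ln (real T / \<delta>)" using one_le_ln[OF elim] ln\<delta>[of T] elim by linarith
        then show ?case using True by (simp add: gam_def)
      qed
    qed
  next
    case False
    define D where "D = (2 powr (2 * \<theta> + 1) + 2) * Gamma (2 * \<theta> + 1)"
    define E where "E = 2 powr (3 * \<theta>) * Gamma (3 * \<theta> + 1)"
    have DE: "D \<ge> 0" "E \<ge> 0" using False
      by (auto simp: D_def E_def intro!: mult_nonneg_nonneg Gamma_real_nonneg)
    have K\<rho>: "0 \<le> K * \<rho>" using K \<rho> \<theta> False by simp
    show ?thesis
    proof (rule bigoI[where c = "8 * (2 * 2 powr (\<theta> - 1) * (K * \<rho>) + 4 * (D + E) * K\<^sup>2)"])
      show "\<forall>\<^sub>F T in sequentially. norm (gam K \<rho> \<delta>\<^sub>2 \<theta> T)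
          \<le> 8 * (2 * 2 powr (\<theta> - 1) * (K * \<rho>) + 4 * (D + E) * K\<^sup>2) * norm (ln (real T / \<delta>) powr max 0 (\<theta> - 1))"
        using eventually_ge_at_top[of "max 3 (nat \<lceil>2 / \<delta>\<^sub>2\<rceil>)"]
      proof eventually_elim
        case (elim T)
        define l where "l = ln (real T / \<delta>)"
        define b where "b = ln (2 * real T / \<delta>\<^sub>2)"
        have T: "T \<ge> 3" "2 / \<delta>\<^sub>2 \<le> real T" using elim by linarith+
        have l: "1 \<le> l" "ln (real T) \<le> l" unfolding l_def using one_le_ln[OF T(1)] ln\<delta>[of T] T by linarith+
        have "ln (real T) \<le> b" unfolding b_def using \<delta>\<^sub>2 T by (intro ln_mono) (auto simp: field_simps)
        then have b1: "1 \<le> b" using one_le_ln[OF T(1)] by linarith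
        have "2 * real T / \<delta>\<^sub>2 = 2 / \<delta>\<^sub>2 * real T" by simp
        also have "\<dots> \<le> real T * real T" using T by (intro mult_right_mono) auto
        finally have "b \<le> ln (real T * real T)" unfolding b_def using T \<delta>\<^sub>2 by (intro ln_mono) auto
        also have "\<dots> \<le> 2 * l" using T l by (simp add: ln_mult)
        finally have "b powr (\<theta> - 1) \<le> (2 * l) powr (\<theta> - 1)"
          using b1 False by (intro powr_mono2) auto
        also have "\<dots> = 2 powr (\<theta> - 1) * l powr (\<theta> - 1)" using l by (simp add: powr_mult)
        finally have bl: "b powr (\<theta> - 1) \<le> 2 powr (\<theta> - 1) * l powr (\<theta> - 1)" .
        have b1': "1 \<le> b powr (\<theta> - 1)" and l1': "1 \<le> l powr (\<theta> - 1)"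
          using b1 l False by (auto intro!: ge_one_powr_ge_zero)
        have "E / (3 * b powr (\<theta> - 1)) \<le> E / 1" using DE b1' by (intro divide_left_mono) auto
        then have R: "4 * (D + E / (3 * b powr (\<theta> - 1))) * K\<^sup>2 \<le> 4 * (D + E) * K\<^sup>2 * 1"
          by (simp add: mult_right_mono)
        also have "\<dots> \<le> 4 * (D + E) * K\<^sup>2 * l powr (\<theta> - 1)" using l1' DE by (intro mult_left_mono) auto
        finally have R: "4 * (D + E / (3 * b powr (\<theta> - 1))) * K\<^sup>2 \<le> 4 * (D + E) * K\<^sup>2 * l powr (\<theta> - 1)" .
        have R0: "0 \<le> 4 * (D + E / (3 * b powr (\<theta> - 1))) * K\<^sup>2" using DE by simp
        have S: "2 * b powr (\<theta> - 1) * K * \<rho> \<le> 2 * 2 powr (\<theta> - 1) * (K * \<rho>) * l powr (\<theta> - 1)"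
          using mult_right_mono[OF bl K\<rho>] by (simp add: mult_ac)
        have S0: "0 \<le> 2 * b powr (\<theta> - 1) * K * \<rho>" using K\<rho> by (simp add: mult.assoc)
        have g: "gam K \<rho> \<delta>\<^sub>2 \<theta> T = 8 * max (2 * b powr (\<theta> - 1) * K * \<rho>) (4 * (D + E / (3 * b powr (\<theta> - 1))) * K\<^sup>2)"
          using False by (simp add: gam_def b_def D_def E_def)
        have max_le: "\<bar>8 * max u v\<bar> \<le> 8 * (u' + v')" if "0 \<le> u" "u \<le> u'" "0 \<le> v" "v \<le> v'" for u v u' v' :: real
          using that by (simp add: max_def)
        have "norm (gam K \<rho> \<delta>\<^sub>2 \<theta> T) \<le> 8 * (2 * 2 powr (\<theta> - 1) * (K * \<rho>) * l powr (\<theta> - 1) + 4 * (D + E) * K\<^sup>2 * l powr (\<theta> - 1))"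
          unfolding g real_norm_def by (rule max_le[OF S0 S R0 R])
        also have "\<dots> = 8 * (2 * 2 powr (\<theta> - 1) * (K * \<rho>) + 4 * (D + E) * K\<^sup>2) * norm (l powr max 0 (\<theta> - 1))"
          using False by (simp add: algebra_simps)
        finally show ?case by (simp add: l_def)
      qed
    qed
  qed
qed

theorem theorem15:
  fixes M :: "'w measure"
    and f :: "real ^ 'd \<Rightarrow> real"
    and x0 :: "real ^ 'd"
    and x g e :: "nat \<Rightarrow> 'w \<Rightarrow> real ^ 'd"
    and \<eta> :: "nat \<Rightarrow> real"
    and fstar L \<rho> K \<theta> c \<delta> \<delta>\<^sub>1 \<delta>\<^sub>2 \<delta>\<^sub>3 :: real
  assumes M: "prob_space M"
    and diff: "\<And>y. f differentiable (at y)"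
    and argmin: "\<exists>y. is_arg_min f (\<lambda>_. True) y \<and> f y = fstar"
    and L: "L > 0"
    and smooth: "smooth_with L f"
    and x_0: "\<And>\<omega>. \<omega> \<in> space M \<Longrightarrow> x 0 \<omega> = x0"
    and x_Suc: "\<And>t \<omega>. \<omega> \<in> space M \<Longrightarrow> x (Suc t) \<omega> = x t \<omega> - \<eta> t *\<^sub>R g t \<omega>"
    and g_meas: "\<And>t. g t \<in> borel_measurable M"
    and e: "\<And>t \<omega>. \<omega> \<in> space M \<Longrightarrow> e t \<omega> = grad f (x t \<omega>) - g t \<omega>"
    and \<theta>: "\<theta> \<ge> 1/2"
    and K: "K > 0"
    and centered: "\<And>t. cond_centered M (past_algebra M e t) (e t)"
    and sub_Weibull: "\<And>t. cond_sub_Weibull M (past_algebra M e t) K \<theta> (\<lambda>\<omega>. norm (e t \<omega>))"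
    and Lipschitz: "\<theta> > 1/2 \<Longrightarrow> lipschitz_on \<rho> UNIV f"
    and \<delta>s: "\<delta>\<^sub>1 \<in> {0<..<1}" "\<delta>\<^sub>2 \<in> {0<..<1}" "\<delta>\<^sub>3 \<in> {0<..<1}"
    and \<delta>: "\<delta> = Max {\<delta>\<^sub>1, \<delta>\<^sub>2, \<delta>\<^sub>3}"
    and c: "0 < c" "c \<le> 1 / L"
    and \<eta>: "\<And>t. \<eta> t = c / sqrt (real t + 1)"
  shows "(\<forall>T\<ge>1. \<P>(\<omega> in M.
             1 / sqrt (real T) * (\<Sum>t<T. 1 / sqrt (real t + 1) * (norm (grad f (x t \<omega>)))\<^sup>2)
               \<le> sgd_bound L c K \<rho> \<theta> (f x0 - fstar) \<delta>\<^sub>1 \<delta>\<^sub>2 \<delta>\<^sub>3 T)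
           \<ge> 1 - \<delta>\<^sub>1 - \<delta>\<^sub>2 - \<delta>\<^sub>3)
       \<and> (\<lambda>T. sgd_bound L c K \<rho> \<theta> (f x0 - fstar) \<delta>\<^sub>1 \<delta>\<^sub>2 \<delta>\<^sub>3 T)
           \<in> O(\<lambda>T. (ln (real T) * ln (1 / \<delta>) powr (2 * \<theta>)
                      + gam K \<rho> \<delta>\<^sub>2 \<theta> T * ln (1 / \<delta>)) / sqrt (real T))
       \<and> (\<lambda>T. gam K \<rho> \<delta>\<^sub>2 \<theta> T) \<in> O(\<lambda>T. ln (real T / \<delta>) powr max 0 (\<theta> - 1))"
proof (intro conjI allI impI)
  have fstar_le: "fstar \<le> f y" for y
    using argmin by (auto simp: is_arg_min_linorder)
  interpret sgd_sub_Weibull M f x0 x g e \<eta> fstar L \<rho> K \<theta> c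
    using M by (intro sgd_sub_Weibull.intro sgd_sub_Weibull_axioms.intro diff fstar_le L smooth x_0 x_Suc
        g_meas e \<theta> K centered sub_Weibull Lipschitz c \<eta>)
  have \<delta>_mem: "\<delta> \<in> {0<..<1}" using \<delta>s unfolding \<delta> by auto
  show "\<P>(\<omega> in M. 1 / sqrt (real T) * (\<Sum>t<T. 1 / sqrt (real t + 1) * (norm (grad f (x t \<omega>)))\<^sup>2)
      \<le> sgd_bound L c K \<rho> \<theta> (f x0 - fstar) \<delta>\<^sub>1 \<delta>\<^sub>2 \<delta>\<^sub>3 T) \<ge> 1 - \<delta>\<^sub>1 - \<delta>\<^sub>2 - \<delta>\<^sub>3" if "T \<ge> 1" for T
    by (rule high_probability_bound[OF that \<delta>s])
  show "(\<lambda>T. sgd_bound L c K \<rho> \<theta> (f x0 - fstar) \<delta>\<^sub>1 \<delta>\<^sub>2 \<delta>\<^sub>3 T)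
      \<in> O(\<lambda>T. (ln (real T) * ln (1 / \<delta>) powr (2 * \<theta>) + gam K \<rho> \<delta>\<^sub>2 \<theta> T * ln (1 / \<delta>)) / sqrt (real T))"
    using gam_pos[OF _ \<delta>s(2)] by (intro sgd_bound_bigo \<delta>s(3) \<delta>_mem) (simp add: less_imp_le)
  show "(\<lambda>T. gam K \<rho> \<delta>\<^sub>2 \<theta> T) \<in> O(\<lambda>T. ln (real T / \<delta>) powr max 0 (\<theta> - 1))"
    using Lipschitz lipschitz_on_nonneg by (intro gam_bigo \<theta> K \<delta>s(2) \<delta>_mem) blast
qed

end
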